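(* If the Banach lattice $E$ fails the positive Schur property, then the sets $$\mathcal{C}_1=\{(x_j)_{j=1}^\infty \in \ell_\infty(E) : (x_j)_{j=1}^\infty \text{ is absolutely weakly null and does not converge to } 0 \text{ in norm}\},$$ $$\mathcal{C}_2=\{(x_j)_{j=1}^\infty \in \ell_\infty(E) : (x_j)_{j=1}^\infty \text{ is disjoint, absolutely weakly null and does not converge to } 0 \text{ in norm}\}$$ are almost positive pointwise latticeable in $\ell_\infty(E)$.
   Context: Banach lattices are real. A Banach lattice has the positive Schur property if positive weakly null sequences are norm null (equivalently, disjoint weakly null sequences are norm null; equivalently, positive disjoint weakly null sequences are norm null). The absolute weak topology $|\sigma|(E,E^* )$ on $E$ is the locally convex-solid topology generated by the seminorms $p_{x^*}(x) = |x^*|(|x|)$, $x^* \in E^*$; a sequence is absolutely weakly null if it converges to $0$ in this topology. A sequence $(x_j)_{j=1}^\infty$ in $E$ is disjoint if $|x_j| \wedge |x_k| = 0$ for $j \neq k$. $\ell_\infty(E)$ is the Banach lattice of bounded $E$-valued sequences with the supremum norm and the pointwise ordering; $X^+$ denotes the positive cone of a Banach lattice $X$. A Banach sequence lattice is a linear subspace $X$ of $E^{\mathbb{N}}$, $E$ a Banach lattice, endowed with a complete norm that makes $X$ a Banach lattice with the pointwise ordering. A subset $B$ of a Banach sequence lattice $X$ with $B \cap X^+ \neq \emptyset$ is almost positive pointwise latticeable (in $X$) if for each positive sequence $\mathbf{x} \in B$ there exists a closed infinite dimensional sublattice of $X$ contained in $B \cup \{0\}$ and containing a subsequence of $\mathbf{x}$.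 *)

theory Defs
  imports
    "HOL-Analysis.Analysis"
    "HOL-Library.Function_Algebras"
    "HOL-Library.Lattice_Algebras"
    "HOL-Library.Lub_Glb"
begin

section \<open>Banach lattices\<close>

class banach_lattice = banach + ordered_real_vector + lattice_ab_group_add_abs +
  assumes norm_le_of_abs_le: "\<bar>x\<bar> \<le> \<bar>y\<bar> \<Longrightarrow> norm x \<le> norm y"

instance real :: banach_lattice
  by standard simp

text \<open>Suprema, infima and moduli with respect to the order restricted to a carrier \<^term>\<open>X\<close>.\<close>

definition sup_in :: "'a::order set \<Rightarrow> 'a \<Rightarrow> 'a \<Rightarrow> 'a" where
  "sup_in X x y = (THE z. isLub X {x, y} z)"

definition inf_in :: "'a::order set \<Rightarrow> 'a \<Rightarrow> 'a \<Rightarrow> 'a" where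
  "inf_in X x y = (THE z. isGlb X {x, y} z)"

definition modulus_in :: "'a::{order, uminus} set \<Rightarrow> 'a \<Rightarrow> 'a" where
  "modulus_in X x = sup_in X x (- x)"

lemma sup_in_eq: "isLub X {x, y} z \<Longrightarrow> sup_in X x y = z"
  unfolding sup_in_def
  by (rule the_equality) (auto intro: order.antisym dest: isLub_isUb isLub_le_isUb)

lemma inf_in_eq:
  assumes "isGlb X {x, y} z"
  shows "inf_in X x y = z"
  unfolding inf_in_def
proof (rule the_equality[where P = "\<lambda>z. isGlb X {x, y} z", OF assms])
  fix w assume "isGlb X {x, y} w"
  with assms show "w = z"
    by (auto simp: isGlb_def greatestP_def isLb_def setle_def setge_def intro: order.antisym)
qed


section \<open>The dual of a Banach lattice and the weak topologies\<close>

text \<open>The dual order: \<open>f \<le> g\<close> iff \<open>f x \<le> g x\<close> for all positive \<open>x\<close>.\<close>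

instantiation blinfun :: (banach_lattice, "{real_normed_vector, order}") order
begin

definition less_eq_blinfun :: "('a \<Rightarrow>\<^sub>L 'b) \<Rightarrow> ('a \<Rightarrow>\<^sub>L 'b) \<Rightarrow> bool" where
  "f \<le> g \<longleftrightarrow> (\<forall>x\<ge>0. blinfun_apply f x \<le> blinfun_apply g x)"

definition less_blinfun :: "('a \<Rightarrow>\<^sub>L 'b) \<Rightarrow> ('a \<Rightarrow>\<^sub>L 'b) \<Rightarrow> bool" where
  "less_blinfun f g \<longleftrightarrow> f \<le> g \<and> \<not> g \<le> f"

instance
proof
  fix f g :: "'a \<Rightarrow>\<^sub>L 'b"
  assume fg: "f \<le> g" "g \<le> f"
  then have pos: "blinfun_apply f x = blinfun_apply g x" if "0 \<le> x" for x
    using that by (auto simp: less_eq_blinfun_def intro: order.antisym)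
  show "f = g"
  proof (rule blinfun_eqI)
    fix x :: 'a
    have "x = pprt x - (- nprt x)" by (simp add: prts[symmetric])
    moreover have "0 \<le> pprt x" "0 \<le> - nprt x" by simp_all
    ultimately show "blinfun_apply f x = blinfun_apply g x"
      by (metis blinfun.diff_right pos)
  qed
qed (auto simp: less_eq_blinfun_def less_blinfun_def intro: order_trans)

end

definition weakly_null :: "(nat \<Rightarrow> 'e::banach_lattice) \<Rightarrow> bool" where
  "weakly_null x \<longleftrightarrow> (\<forall>f :: 'e \<Rightarrow>\<^sub>L real. (\<lambda>n. blinfun_apply f (x n)) \<longlonglongrightarrow> 0)"

definition positive_schur_property :: "'e::banach_lattice itself \<Rightarrow> bool" where
  "positive_schur_property _ \<longleftrightarrow>
    (\<forall>x :: nat \<Rightarrow> 'e. (\<forall>n. 0 \<le> x n) \<longrightarrow> weakly_null x \<longrightarrow> x \<longlonglongrightarrow> 0)"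

text \<open>
  The seminorm \<open>|f|(|x|)\<close>, where \<open>|f|\<close> is the supremum of \<open>f\<close> and \<open>-f\<close> in the dual order; it exists by
  the Riesz-Kantorovich theorem.
\<close>

definition abs_seminorm :: "('e::banach_lattice \<Rightarrow>\<^sub>L real) \<Rightarrow> 'e \<Rightarrow> real" where
  "abs_seminorm f x = blinfun_apply (modulus_in UNIV f) \<bar>x\<bar>"

definition absolute_weak_topology :: "'e::banach_lattice topology" where
  "absolute_weak_topology =
    topology_generated_by {{y. abs_seminorm f (y - x) < \<epsilon>} | f x \<epsilon>. 0 < \<epsilon>}"

definition absolutely_weakly_null :: "(nat \<Rightarrow> 'e::banach_lattice) \<Rightarrow> bool" where
  "absolutely_weakly_null x \<longleftrightarrow> limitin absolute_weak_topology x 0 sequentially"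

definition disjoint_sequence :: "(nat \<Rightarrow> 'e::banach_lattice) \<Rightarrow> bool" where
  "disjoint_sequence x \<longleftrightarrow> (\<forall>j k. j \<noteq> k \<longrightarrow> inf \<bar>x j\<bar> \<bar>x k\<bar> = 0)"


section \<open>Banach sequence lattices\<close>

instantiation "fun" :: (type, real_vector) real_vector
begin

definition scaleR_fun :: "real \<Rightarrow> ('a \<Rightarrow> 'b) \<Rightarrow> 'a \<Rightarrow> 'b" where
  "c *\<^sub>R f = (\<lambda>x. c *\<^sub>R f x)"

instance
  by standard (auto simp: scaleR_fun_def fun_eq_iff scaleR_add_right scaleR_add_left)

end

text \<open>
  The distance induced by a norm \<^term>\<open>N\<close> on \<^term>\<open>X\<close>. It is set to 0 outside \<^term>\<open>X\<close>
  because the locale \<^locale>\<open>Metric_space\<close> wants a nonnegative symmetric function on the whole type.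
\<close>

definition norm_dist :: "'a::minus set \<Rightarrow> ('a \<Rightarrow> real) \<Rightarrow> 'a \<Rightarrow> 'a \<Rightarrow> real" where
  "norm_dist X N x y = (if x \<in> X \<and> y \<in> X then N (x - y) else 0)"

definition norm_on :: "'a::real_vector set \<Rightarrow> ('a \<Rightarrow> real) \<Rightarrow> bool" where
  "norm_on X N \<longleftrightarrow>
    (\<forall>x\<in>X. 0 \<le> N x \<and> (N x = 0 \<longleftrightarrow> x = 0)) \<and>
    (\<forall>x\<in>X. \<forall>y\<in>X. N (x + y) \<le> N x + N y) \<and>
    (\<forall>x\<in>X. \<forall>c. N (c *\<^sub>R x) = \<bar>c\<bar> * N x)"

text \<open>
  The order on \<^typ>\<open>nat \<Rightarrow> 'e\<close> is the pointwise one. The lattice operations of \<^term>\<open>X\<close> are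
  those of the order restricted to \<^term>\<open>X\<close>; a priori they need not be computed coordinatewise.
\<close>

definition banach_sequence_lattice ::
    "(nat \<Rightarrow> 'e::banach_lattice) set \<Rightarrow> ((nat \<Rightarrow> 'e) \<Rightarrow> real) \<Rightarrow> bool" where
  "banach_sequence_lattice X N \<longleftrightarrow>
    subspace X \<and> norm_on X N \<and> Metric_space.mcomplete X (norm_dist X N) \<and>
    (\<forall>x\<in>X. \<forall>y\<in>X. (\<exists>z. isLub X {x, y} z) \<and> (\<exists>z. isGlb X {x, y} z)) \<and>
    (\<forall>x\<in>X. \<forall>y\<in>X. modulus_in X x \<le> modulus_in X y \<longrightarrow> N x \<le> N y)"

definition sublattice_of ::
    "(nat \<Rightarrow> 'e::banach_lattice) set \<Rightarrow> (nat \<Rightarrow> 'e) set \<Rightarrow> bool" where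
  "sublattice_of X Y \<longleftrightarrow>
    Y \<subseteq> X \<and> subspace Y \<and> (\<forall>x\<in>Y. \<forall>y\<in>Y. sup_in X x y \<in> Y \<and> inf_in X x y \<in> Y)"

definition infinite_dimensional :: "'a::real_vector set \<Rightarrow> bool" where
  "infinite_dimensional Y \<longleftrightarrow> \<not> (\<exists>B. finite B \<and> Y \<subseteq> span B)"

definition almost_positive_pointwise_latticeable ::
    "(nat \<Rightarrow> 'e::banach_lattice) set \<Rightarrow> ((nat \<Rightarrow> 'e) \<Rightarrow> real) \<Rightarrow> (nat \<Rightarrow> 'e) set \<Rightarrow> bool" where
  "almost_positive_pointwise_latticeable X N B \<longleftrightarrow>
    banach_sequence_lattice X N \<and> B \<subseteq> X \<and> (\<exists>x\<in>B. 0 \<le> x) \<and>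
    (\<forall>x\<in>B. 0 \<le> x \<longrightarrow>
      (\<exists>Y. sublattice_of X Y \<and> closedin (Metric_space.mtopology X (norm_dist X N)) Y \<and>
           infinite_dimensional Y \<and> Y \<subseteq> B \<union> {0} \<and>
           (\<exists>r. strict_mono r \<and> x \<circ> r \<in> Y)))"

definition linfty :: "(nat \<Rightarrow> 'e::banach_lattice) set" where
  "linfty = {x. bounded (range x)}"

definition sup_norm :: "(nat \<Rightarrow> 'e::banach_lattice) \<Rightarrow> real" where
  "sup_norm x = (SUP n. norm (x n))"


subsection \<open>Bounded sequences form a Banach sequence lattice\<close>

lemma norm_abs_bl: "norm \<bar>x::'e::banach_lattice\<bar> = norm x"
  by (intro order.antisym norm_le_of_abs_le) simp_all

lemma norm_sup_le: "norm (sup x y) \<le> norm x + norm (y::'e::banach_lattice)"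
proof -
  have x: "x \<le> \<bar>x\<bar> + \<bar>y\<bar>" "- x \<le> \<bar>x\<bar> + \<bar>y\<bar>"
    by (rule add_increasing2[OF abs_ge_zero abs_ge_self],
        rule add_increasing2[OF abs_ge_zero abs_ge_minus_self])
  have y: "y \<le> \<bar>x\<bar> + \<bar>y\<bar>"
    by (rule add_increasing[OF abs_ge_zero abs_ge_self])
  have "- sup x y \<le> \<bar>x\<bar> + \<bar>y\<bar>"
    by (rule order_trans[OF _ x(2)]) simp
  then have "\<bar>sup x y\<bar> \<le> \<bar>x\<bar> + \<bar>y\<bar>"
    using x y by (intro abs_leI) simp_all
  then have "\<bar>sup x y\<bar> \<le> \<bar>\<bar>x\<bar> + \<bar>y\<bar>\<bar>"
    by (rule order_trans[OF _ abs_ge_self])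
  then have "norm (sup x y) \<le> norm (\<bar>x\<bar> + \<bar>y\<bar>)" by (rule norm_le_of_abs_le)
  also have "\<dots> \<le> norm x + norm y" using norm_triangle_ineq[of "\<bar>x\<bar>" "\<bar>y\<bar>"] by (simp only: norm_abs_bl)
  finally show ?thesis .
qed

lemma linfty_iff: "x \<in> linfty \<longleftrightarrow> bdd_above (range (\<lambda>n. norm (x n)))"
  unfolding linfty_def bounded_iff bdd_above_def by auto

lemma norm_le_sup_norm: "x \<in> linfty \<Longrightarrow> norm (x n) \<le> sup_norm x"
  unfolding sup_norm_def linfty_iff by (rule cSUP_upper) auto

lemma sup_norm_le: "(\<And>n. norm (x n) \<le> c) \<Longrightarrow> sup_norm x \<le> c"
  unfolding sup_norm_def by (rule cSUP_least) auto

lemma linftyI: "(\<And>n. norm (x n) \<le> c) \<Longrightarrow> x \<in> linfty"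
  unfolding linfty_iff by (rule bdd_aboveI2)

lemma subspace_linfty: "subspace linfty"
proof (rule subspaceI)
  show "(0 :: nat \<Rightarrow> 'e::banach_lattice) \<in> linfty" by (rule linftyI[of _ 0]) simp
next
  fix x y :: "nat \<Rightarrow> 'e::banach_lattice" assume "x \<in> linfty" "y \<in> linfty"
  then show "x + y \<in> linfty"
    by (intro linftyI[of _ "sup_norm x + sup_norm y"])
       (auto intro!: norm_triangle_le add_mono norm_le_sup_norm)
next
  fix x :: "nat \<Rightarrow> 'e::banach_lattice" and c assume "x \<in> linfty"
  then show "c *\<^sub>R x \<in> linfty"
    by (intro linftyI[of _ "\<bar>c\<bar> * sup_norm x"])
       (auto simp: scaleR_fun_def intro!: mult_left_mono norm_le_sup_norm)
qed

lemma norm_on_linfty: "norm_on linfty sup_norm"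
  unfolding norm_on_def
proof (intro conjI ballI allI)
  fix x :: "nat \<Rightarrow> 'e::banach_lattice" assume x: "x \<in> linfty"
  show nn: "0 \<le> sup_norm x" using norm_le_sup_norm[OF x] norm_ge_zero order_trans by blast
  show "sup_norm x = 0 \<longleftrightarrow> x = 0"
    using norm_le_sup_norm[OF x] nn by (auto simp: fun_eq_iff sup_norm_def)
  fix c
  show "sup_norm (c *\<^sub>R x) = \<bar>c\<bar> * sup_norm x"
  proof (rule order.antisym)
    show "sup_norm (c *\<^sub>R x) \<le> \<bar>c\<bar> * sup_norm x"
      by (rule sup_norm_le) (auto simp: scaleR_fun_def intro!: mult_left_mono norm_le_sup_norm x)
    show "\<bar>c\<bar> * sup_norm x \<le> sup_norm (c *\<^sub>R x)"
    proof (cases "c = 0")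
      case True then show ?thesis by (simp add: sup_norm_def scaleR_fun_def)
    next
      case False
      have "c *\<^sub>R x \<in> linfty" using subspace_linfty x by (rule subspace_scale)
      from norm_le_sup_norm[OF this] have "sup_norm x \<le> sup_norm (c *\<^sub>R x) / \<bar>c\<bar>"
        using False by (intro sup_norm_le) (auto simp: scaleR_fun_def field_simps)
      then show ?thesis using False by (simp add: field_simps)
    qed
  qed
next
  fix x y :: "nat \<Rightarrow> 'e::banach_lattice" assume "x \<in> linfty" "y \<in> linfty"
  then show "sup_norm (x + y) \<le> sup_norm x + sup_norm y"
    by (intro sup_norm_le) (auto intro!: norm_triangle_le add_mono norm_le_sup_norm)
qed

lemma isLub_linfty:
  assumes "x \<in> linfty" "y \<in> linfty" shows "isLub linfty {x, y} (sup x y)"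
proof -
  have "sup x y \<in> linfty"
    using assms by (intro linftyI[of _ "sup_norm x + sup_norm y"])
       (auto intro!: order_trans[OF norm_sup_le] add_mono norm_le_sup_norm)
  then show ?thesis
    by (auto simp: isLub_def leastP_def isUb_def setle_def setge_def)
qed

lemma isGlb_linfty:
  assumes "x \<in> linfty" "y \<in> linfty" shows "isGlb linfty {x, y} (inf x y)"
proof -
  have "-x \<in> linfty" "-y \<in> linfty" using assms subspace_linfty by (auto intro: subspace_neg)
  then have "- sup (-x) (-y) \<in> linfty"
    using isLub_linfty isLubD1a subspace_linfty subspace_neg by blast
  moreover have "- sup (-x) (-y) = inf x y"
    by (auto simp: fun_eq_iff neg_sup_eq_inf)
  ultimately have "inf x y \<in> linfty" by simp
  then show ?thesis
    by (auto simp: isGlb_def greatestP_def isLb_def setle_def setge_def)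
qed

lemma modulus_linfty: "x \<in> linfty \<Longrightarrow> modulus_in linfty x = (\<lambda>n. \<bar>x n\<bar>)"
  unfolding modulus_in_def
  using sup_in_eq[OF isLub_linfty[of x "-x"]] subspace_neg[OF subspace_linfty, of x]
  by (auto simp: fun_eq_iff abs_lattice)

lemma Metric_space_linfty: "Metric_space linfty (norm_dist linfty sup_norm)"
proof
  note no = norm_on_linfty[unfolded norm_on_def, THEN conjunct1, rule_format]
  note tri = norm_on_linfty[unfolded norm_on_def, THEN conjunct2, THEN conjunct1, rule_format]
  note sd = subspace_diff[OF subspace_linfty]
  fix x y z :: "nat \<Rightarrow> 'e::banach_lattice"
  show "0 \<le> norm_dist linfty sup_norm x y" using no sd by (auto simp: norm_dist_def)
  show "norm_dist linfty sup_norm x y = norm_dist linfty sup_norm y x"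
    by (auto simp: norm_dist_def sup_norm_def norm_minus_commute)
  assume x: "x \<in> linfty" and y: "y \<in> linfty"
  have "sup_norm (x - y) = 0 \<longleftrightarrow> x - y = 0"
    using no[OF sd[OF x y]] by (rule conjunct2)
  then show "(norm_dist linfty sup_norm x y = 0) = (x = y)"
    using x y by (simp only: norm_dist_def right_minus_eq if_True simp_thms)
  assume z: "z \<in> linfty"
  have "sup_norm ((x - y) + (y - z)) \<le> sup_norm (x - y) + sup_norm (y - z)"
    by (rule tri[OF sd[OF x y] sd[OF y z]])
  then show "norm_dist linfty sup_norm x z \<le> norm_dist linfty sup_norm x y + norm_dist linfty sup_norm y z"
    using x y z by (simp add: norm_dist_def)
qed

lemma mcomplete_linfty: "Metric_space.mcomplete linfty (norm_dist linfty (sup_norm::(nat\<Rightarrow>'e::banach_lattice)\<Rightarrow>real))"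
proof -
  interpret L: Metric_space linfty "norm_dist linfty (sup_norm::(nat\<Rightarrow>'e)\<Rightarrow>real)"
    by (rule Metric_space_linfty)
  show ?thesis unfolding L.mcomplete_def
  proof (intro allI impI)
    fix s :: "nat \<Rightarrow> nat \<Rightarrow> 'e" assume s: "L.MCauchy s"
    then have sl: "s k \<in> linfty" for k by (auto simp: L.MCauchy_def)
    have C: "\<exists>M. \<forall>m\<ge>M. \<forall>n\<ge>M. \<forall>i. dist (s m i) (s n i) < e" if "e > 0" for e
    proof -
      obtain M where M: "\<And>m n. M \<le> m \<Longrightarrow> M \<le> n \<Longrightarrow> norm_dist linfty sup_norm (s m) (s n) < e"
        using s \<open>e > 0\<close> unfolding L.MCauchy_def by blast
      have "dist (s m i) (s n i) < e" if "M \<le> m" "M \<le> n" for m n i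
        using M[OF that] norm_le_sup_norm[OF subspace_diff[OF subspace_linfty sl sl], of m n i]
        by (simp add: norm_dist_def sl dist_norm)
      then show ?thesis by blast
    qed
    have "uniformly_Cauchy_on UNIV s"
      unfolding uniformly_Cauchy_on_def
    proof (intro allI impI)
      fix e :: real assume "e > 0"
      from C[OF this] obtain M where M: "\<forall>m\<ge>M. \<forall>n\<ge>M. \<forall>i. dist (s m i) (s n i) < e" ..
      show "\<exists>M. \<forall>x\<in>UNIV. \<forall>m\<ge>M. \<forall>n\<ge>M. dist (s m x) (s n x) < e"
        by (rule exI[of _ M]) (use M in blast)
    qed
    then obtain l where l: "uniform_limit UNIV s l sequentially"
      using Cauchy_uniformly_convergent uniformly_convergent_on_def by blast
    have U: "\<exists>M. \<forall>n\<ge>M. \<forall>i. dist (s n i) (l i) < e" if "e>0" for e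
      using l that unfolding uniform_limit_iff eventually_sequentially by auto
    obtain M where M: "\<And>i. dist (s M i) (l i) < 1" using U[of 1] by auto
    have ll: "l \<in> linfty"
    proof (rule linftyI)
      fix i
      have "norm (l i) \<le> norm (s M i) + dist (s M i) (l i)"
        by (simp add: dist_norm norm_triangle_sub norm_minus_commute)
      also have "\<dots> \<le> sup_norm (s M) + 1" using M[of i] norm_le_sup_norm[OF sl] by (intro add_mono) (auto intro: less_imp_le)
      finally show "norm (l i) \<le> sup_norm (s M) + 1" .
    qed
    have "limitin L.mtopology s l sequentially"
      unfolding L.limitin_metric eventually_sequentially
    proof (intro conjI ll allI impI)
      fix e :: real assume "e > 0"
      then obtain M where M: "\<And>n i. M \<le> n \<Longrightarrow> dist (s n i) (l i) < e/2" using U[of "e/2"] by auto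
      have "norm_dist linfty sup_norm (s n) l < e" if "M \<le> n" for n
      proof -
        have "sup_norm (s n - l) \<le> e/2"
          using M[OF that] by (intro sup_norm_le) (auto simp: dist_norm intro: less_imp_le)
        then show ?thesis using \<open>e > 0\<close> sl ll by (simp add: norm_dist_def)
      qed
      then show "\<exists>N. \<forall>n\<ge>N. s n \<in> linfty \<and> norm_dist linfty sup_norm (s n) l < e" using sl by blast
    qed
    then show "\<exists>l. limitin L.mtopology s l sequentially" by blast
  qed
qed

theorem banach_sequence_lattice_linfty: "banach_sequence_lattice linfty sup_norm"
  unfolding banach_sequence_lattice_def
proof (intro conjI ballI impI)
  fix x y :: "nat \<Rightarrow> 'e::banach_lattice" assume x: "x \<in> linfty" and y: "y \<in> linfty"
  show "\<exists>z. isLub linfty {x, y} z" "\<exists>z. isGlb linfty {x, y} z"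
    using isLub_linfty[OF x y] isGlb_linfty[OF x y] by blast+
  assume "modulus_in linfty x \<le> modulus_in linfty y"
  then have "norm (x n) \<le> norm (y n)" for n
    using x y by (auto simp: modulus_linfty le_fun_def intro: norm_le_of_abs_le)
  then show "sup_norm x \<le> sup_norm y"
    using norm_le_sup_norm[OF y] by (intro sup_norm_le) (meson order_trans)
qed (rule subspace_linfty norm_on_linfty mcomplete_linfty)+

end

theory Submission
  imports Defs
begin

text \<open>
  Let \<open>x\<close> be a positive member of one of the two sets. Some subsequence \<open>y = x \<circ> r\<close> has norms bounded below by
  \<open>e > 0\<close>. Split the indices into infinitely many infinite blocks and let \<open>Y\<close> consist of the bounded sequences
  that arise from \<open>y\<close> by multiplying it with one scalar per block. Because \<open>y\<close> is positive, \<open>Y\<close> is a sublattice;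
  because the norms of \<open>y\<close> are bounded above and away from \<open>0\<close>, it is a closed copy of the real sequence
  space \<open>\<ell>\<^sub>\<infinity>\<close>. It contains \<open>y\<close>, with all scalars \<open>1\<close>. A nonzero element carries a nonzero scalar on an infinite
  block and so is not norm null, and it is dominated by a multiple of \<open>y\<close>, so it inherits absolute weak nullity
  and disjointness (\<open>closed_sublattice_through_subsequence\<close>).

  It remains to find a positive member, which is where the failure of the positive Schur property enters. For
  positive sequences, weakly null and absolutely weakly null are the same, so the first set is easy. For the
  second set a positive weakly null sequence that is not norm null has to be made disjoint without losing these
  properties (\<open>positive_disjoint_weakly_null_exists\<close>). The new terms are truncations
  \<open>(x k - c k \<Sum>i<k. x i - v k)\<^sup>+\<close> of a subsequence: the sum removes the earlier terms, \<open>v k\<close> removes the later ones,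
  and domination by the old terms preserves weak nullity. If the sequence cannot nearly be dominated by one
  element, a subsequence keeps its norm under the first subtraction by construction. Otherwise it may be
  assumed order bounded, and norming functionals together with a limit functional select the subsequence.

  The tools are a Hahn-Banach theorem for sublinear functions, used for positive norming functionals and for
  the limit functional, and the Riesz-Kantorovich formula for the modulus of a functional. The latter shows
  that the seminorms \<open>abs_seminorm f\<close> are given by positive functionals; this gives the triangle inequality behind
  the description of absolute weak convergence by seminorms, and the domination arguments.
\<close>

section \<open>A Hahn-Banach theorem\<close>

definition sublinear :: "('a::real_vector \<Rightarrow> real) \<Rightarrow> bool" where
  "sublinear p \<longleftrightarrow> (\<forall>x y. p (x + y) \<le> p x + p y) \<and> (\<forall>t x. 0 \<le> t \<longrightarrow> p (t *\<^sub>R x) \<le> t * p x)"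

lemma sublinear_add: "sublinear p \<Longrightarrow> p (x + y) \<le> p x + p y"
  by (simp add: sublinear_def)

lemma sublinear_scale:
  assumes "sublinear p" "0 \<le> t"
  shows "p (t *\<^sub>R x) = t * p x"
proof (cases "t = 0")
  case True
  have "p 0 \<le> 0"
    using assms(1) unfolding sublinear_def by (metis mult_zero_left order.refl scaleR_zero_left)
  moreover have "0 \<le> p 0" using sublinear_add[OF assms(1), of 0 0] by simp
  ultimately show ?thesis using True by simp
next
  case False
  have "p ((1 / t) *\<^sub>R (t *\<^sub>R x)) \<le> 1 / t * p (t *\<^sub>R x)"
    using assms unfolding sublinear_def by (metis zero_le_divide_1_iff)
  then have "t * p x \<le> p (t *\<^sub>R x)" using assms(2) False by (simp add: field_simps)
  moreover have "p (t *\<^sub>R x) \<le> t * p x" using assms by (simp add: sublinear_def)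
  ultimately show ?thesis by simp
qed

lemma sublinear_zero: "sublinear p \<Longrightarrow> p 0 = 0"
  using sublinear_scale[of p 0 0] by simp

lemma sublinear_lower: "sublinear p \<Longrightarrow> - p (- x) \<le> p x"
  using sublinear_add[of p x "- x"] by (simp add: sublinear_zero)

text \<open>
  Infima of sublinear functions need not be subadditive. The directedness condition on the values is what
  the lowering in a direction, the infimum of a chain and the upper limit of a sequence of functionals have
  in common.
\<close>

lemma sublinear_Inf:
  fixes S :: "'a::real_vector \<Rightarrow> real set"
  assumes ne: "\<And>x. S x \<noteq> {}" and bdd: "\<And>x. bdd_below (S x)"
    and add: "\<And>x y c d. c \<in> S x \<Longrightarrow> d \<in> S y \<Longrightarrow> \<exists>e\<in>S (x + y). e \<le> c + d"
    and scale: "\<And>t x c. 0 \<le> t \<Longrightarrow> c \<in> S x \<Longrightarrow> \<exists>e\<in>S (t *\<^sub>R x). e \<le> t * c"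
  shows "sublinear (\<lambda>x. Inf (S x))"
  unfolding sublinear_def
proof (intro conjI allI impI)
  fix x y
  have le: "Inf (S (x + y)) \<le> c + d" if "c \<in> S x" "d \<in> S y" for c d
    using add[OF that] cInf_lower[OF _ bdd] order_trans by blast
  have "Inf (S (x + y)) - d \<le> Inf (S x)" if "d \<in> S y" for d
    using le[OF _ that] by (intro cInf_greatest ne) (simp add: diff_le_eq)
  then have "Inf (S (x + y)) - Inf (S x) \<le> Inf (S y)"
    by (intro cInf_greatest ne) (simp add: algebra_simps)
  then show "Inf (S (x + y)) \<le> Inf (S x) + Inf (S y)" by simp
next
  fix t x assume t: "0 \<le> (t::real)"
  have le: "Inf (S (t *\<^sub>R x)) \<le> t * c" if "c \<in> S x" for c
    using scale[OF t that] cInf_lower[OF _ bdd] order_trans by blast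
  show "Inf (S (t *\<^sub>R x)) \<le> t * Inf (S x)"
  proof (cases "t = 0")
    case True then show ?thesis using le ne by fastforce
  next
    case False
    then have "Inf (S (t *\<^sub>R x)) / t \<le> Inf (S x)"
      using le t by (intro cInf_greatest ne) (simp add: divide_le_eq mult.commute)
    then show ?thesis using False t by (simp add: field_simps)
  qed
qed

text \<open>
  The witness is \<open>q' x = inf {q (x + t y) - t q y | t \<ge> 0}\<close>. A linear function \<open>g \<le> q\<close> with \<open>g y = q y\<close> has to
  stay below it, because \<open>g x = g (x + t y) - t q y\<close>.
\<close>

lemma sublinear_lowering:
  assumes q: "sublinear q"
  obtains q' where "sublinear q'" "q' \<le> q" "\<And>x. q' x \<le> q (x + y) - q y"
proof
  define S where "S x = {q (x + t *\<^sub>R y) - t * q y | t. 0 \<le> t}" for x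
  have bdd: "bdd_below (S x)" for x
  proof (rule bdd_belowI)
    fix c assume "c \<in> S x"
    then obtain t where t: "0 \<le> t" "c = q (x + t *\<^sub>R y) - t * q y" by (auto simp: S_def)
    show "- q (- x) \<le> c"
      using sublinear_add[OF q, of "x + t *\<^sub>R y" "- x"] t sublinear_scale[OF q t(1), of y] by simp
  qed
  show "sublinear (\<lambda>x. Inf (S x))"
  proof (rule sublinear_Inf[OF _ bdd])
    show "S x \<noteq> {}" for x by (auto simp: S_def intro: exI[of _ 0])
  next
    fix a b c d assume "c \<in> S a" "d \<in> S b"
    then obtain s t where st: "0 \<le> s" "c = q (a + s *\<^sub>R y) - s * q y"
        "0 \<le> t" "d = q (b + t *\<^sub>R y) - t * q y" by (auto simp: S_def)
    have "q (a + b + (s + t) *\<^sub>R y) - (s + t) * q y \<in> S (a + b)"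
      unfolding S_def using st by (intro CollectI exI[of _ "s + t"]) simp
    moreover have "q (a + b + (s + t) *\<^sub>R y) - (s + t) * q y \<le> c + d"
      using sublinear_add[OF q, of "a + s *\<^sub>R y" "b + t *\<^sub>R y"] st by (simp add: algebra_simps)
    ultimately show "\<exists>e\<in>S (a + b). e \<le> c + d" by blast
  next
    fix t a c assume t: "0 \<le> (t::real)" and "c \<in> S a"
    then obtain s where s: "0 \<le> s" "c = q (a + s *\<^sub>R y) - s * q y" by (auto simp: S_def)
    have "q (t *\<^sub>R a + (t * s) *\<^sub>R y) - t * s * q y \<in> S (t *\<^sub>R a)"
      unfolding S_def using s t by (intro CollectI exI[of _ "t * s"]) simp
    moreover have "q (t *\<^sub>R a + (t * s) *\<^sub>R y) - t * s * q y = t * c"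
      using sublinear_scale[OF q t, of "a + s *\<^sub>R y"] s by (simp add: scaleR_add_right right_diff_distrib)
    ultimately show "\<exists>e\<in>S (t *\<^sub>R a). e \<le> t * c" by (metis order.refl)
  qed
  have mem: "q (x + t *\<^sub>R y) - t * q y \<in> S x" if "0 \<le> t" for x t
    using that by (auto simp: S_def)
  show "(\<lambda>x. Inf (S x)) \<le> q"
    using cInf_lower[OF mem[of 0] bdd] by (auto simp: le_fun_def)
  show "Inf (S x) \<le> q (x + y) - q y" for x
    using cInf_lower[OF mem[of 1 x] bdd] by simp
qed

text \<open>
  A minimal sublinear function equals its own lowering in every direction, and this makes it additive.
  Hence Zorn's lemma, applied below the lowering of \<open>p\<close> at \<open>x\<^sub>0\<close>, yields the theorem.
\<close>

theorem hahn_banach_sublinear: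
  fixes p :: "'a::real_vector \<Rightarrow> real"
  assumes p: "sublinear p"
  obtains g where "linear g" "\<And>x. g x \<le> p x" "g x\<^sub>0 = p x\<^sub>0"
proof -
  obtain p\<^sub>0 where p0: "sublinear p\<^sub>0" "p\<^sub>0 \<le> p" "\<And>x. p\<^sub>0 x \<le> p (x + x\<^sub>0) - p x\<^sub>0"
    using sublinear_lowering[OF p, where y = x\<^sub>0] by metis
  define A where "A = {q. sublinear q \<and> q \<le> p\<^sub>0}"
  define P :: "('a \<Rightarrow> real) \<Rightarrow> ('a \<Rightarrow> real) \<Rightarrow> bool" where "P q q' \<longleftrightarrow> q' \<le> q" for q q'
  have "\<exists>m\<in>A. \<forall>q\<in>A. P m q \<longrightarrow> q = m"
  proof (rule predicate_Zorn)
    show "partial_order_on A (relation_of P A)"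
      by (rule partial_order_on_relation_ofI) (auto simp: P_def)
    fix C assume C: "C \<in> Chains (relation_of P A)"
    then have CA: "C \<subseteq> A" and total: "\<And>q q'. q \<in> C \<Longrightarrow> q' \<in> C \<Longrightarrow> q \<le> q' \<or> q' \<le> q"
      by (auto simp: Chains_def relation_of_def P_def)
    show "\<exists>u\<in>A. \<forall>q\<in>C. P q u"
    proof (cases "C = {}")
      case True then show ?thesis using p0 by (auto simp: A_def)
    next
      case False
      define S where "S x = (\<lambda>q. q x) ` C" for x
      have bdd: "bdd_below (S x)" for x
      proof (rule bdd_belowI)
        fix c assume "c \<in> S x"
        then obtain q where q: "q \<in> C" "c = q x" by (auto simp: S_def)
        then have "sublinear q" "q (- x) \<le> p\<^sub>0 (- x)" using CA by (auto simp: A_def le_fun_def)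
        then show "- p\<^sub>0 (- x) \<le> c" using sublinear_lower[of q x] q by simp
      qed
      have "sublinear (\<lambda>x. Inf (S x))"
      proof (rule sublinear_Inf[OF _ bdd])
        show "S x \<noteq> {}" for x using False by (simp add: S_def)
      next
        fix x y c d assume "c \<in> S x" "d \<in> S y"
        then obtain q q' where q: "q \<in> C" "q' \<in> C" "c = q x" "d = q' y" by (auto simp: S_def)
        then obtain r where r: "r \<in> C" "r \<le> q" "r \<le> q'" using total by blast
        then have "r (x + y) \<le> r x + r y" using CA by (auto simp: A_def intro: sublinear_add)
        also have "\<dots> \<le> c + d" using r q by (simp add: le_fun_def add_mono)
        finally show "\<exists>e\<in>S (x + y). e \<le> c + d" using r by (auto simp: S_def)
      next
        fix t x c assume "0 \<le> (t::real)" "c \<in> S x"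
        then show "\<exists>e\<in>S (t *\<^sub>R x). e \<le> t * c"
          using CA unfolding S_def A_def sublinear_def by blast
      qed
      moreover have low: "(\<lambda>x. Inf (S x)) \<le> q" if "q \<in> C" for q
      proof (rule le_funI)
        fix x
        have "q x \<in> S x" using that by (auto simp: S_def)
        then show "Inf (S x) \<le> q x" by (rule cInf_lower[OF _ bdd])
      qed
      moreover have "(\<lambda>x. Inf (S x)) \<le> p\<^sub>0"
      proof -
        obtain q where q: "q \<in> C" using False by blast
        then have "q \<le> p\<^sub>0" using CA by (auto simp: A_def)
        with low[OF q] show ?thesis by (rule order_trans)
      qed
      ultimately show ?thesis by (auto simp: A_def P_def)
    qed
  qed
  then obtain g where g: "sublinear g" "g \<le> p\<^sub>0"
    and min: "\<And>q. sublinear q \<Longrightarrow> q \<le> g \<Longrightarrow> q = g"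
    by (auto simp: A_def P_def intro: order_trans)
  have add: "g (x + y) = g x + g y" for x y
  proof -
    obtain q' where "sublinear q'" "q' \<le> g" "\<And>x. q' x \<le> g (x + y) - g y"
      using sublinear_lowering[OF g(1), where y = y] by metis
    with min have "g x \<le> g (x + y) - g y" by metis
    with sublinear_add[OF g(1), of x y] show ?thesis by simp
  qed
  have neg: "g (- x) = - g x" for x
    using add[of x "- x"] by (simp add: sublinear_zero[OF g(1)])
  have "linear g"
  proof (rule linearI[OF add])
    fix t x
    show "g (t *\<^sub>R x) = t *\<^sub>R g x"
      using sublinear_scale[OF g(1), of t x] sublinear_scale[OF g(1), of "- t" x] neg[of "t *\<^sub>R x"]
      by (cases "0 \<le> t") auto
  qed
  moreover have le: "g x \<le> p x" for x
    using g(2) p0(2) by (meson le_fun_def order_trans)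
  moreover have "g x\<^sub>0 = p x\<^sub>0"
  proof (rule order.antisym[OF le])
    have "g (- x\<^sub>0) \<le> p\<^sub>0 (- x\<^sub>0)" using g(2) by (simp add: le_fun_def)
    also have "\<dots> \<le> - p x\<^sub>0" using p0(3)[of "- x\<^sub>0"] by (simp add: sublinear_zero[OF p])
    finally show "p x\<^sub>0 \<le> g x\<^sub>0" by (simp add: neg)
  qed
  ultimately show thesis using that by blast
qed

section \<open>Positive parts and positive functionals in Banach lattices\<close>

lemma scaleR_sup:
  fixes a b :: "'e::banach_lattice"
  assumes "0 \<le> t" shows "t *\<^sub>R sup a b = sup (t *\<^sub>R a) (t *\<^sub>R b)"
proof (cases "t = 0")
  case False
  with assms have t: "0 < t" by simp
  have "a \<le> (1 / t) *\<^sub>R sup (t *\<^sub>R a) (t *\<^sub>R b)"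
    using scaleR_left_mono[of "t *\<^sub>R a" "sup (t *\<^sub>R a) (t *\<^sub>R b)" "1 / t"] t by simp
  moreover have "b \<le> (1 / t) *\<^sub>R sup (t *\<^sub>R a) (t *\<^sub>R b)"
    using scaleR_left_mono[of "t *\<^sub>R b" "sup (t *\<^sub>R a) (t *\<^sub>R b)" "1 / t"] t by simp
  ultimately have "sup a b \<le> (1 / t) *\<^sub>R sup (t *\<^sub>R a) (t *\<^sub>R b)" by simp
  from scaleR_left_mono[OF this assms] have "t *\<^sub>R sup a b \<le> sup (t *\<^sub>R a) (t *\<^sub>R b)"
    using t by simp
  then show ?thesis
    by (rule order.antisym) (simp add: assms scaleR_left_mono)
qed simp

lemma pprt_scaleR: "0 \<le> t \<Longrightarrow> pprt (t *\<^sub>R x) = t *\<^sub>R pprt (x::'e::banach_lattice)"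
  unfolding pprt_def by (simp add: scaleR_sup)

lemma abs_scaleR: "\<bar>t *\<^sub>R x\<bar> = \<bar>t\<bar> *\<^sub>R \<bar>x::'e::banach_lattice\<bar>"
proof -
  have nonneg: "\<bar>s *\<^sub>R x\<bar> = s *\<^sub>R \<bar>x\<bar>" if "0 \<le> s" for s
    using that unfolding abs_lattice[where 'a = 'e] by (simp add: scaleR_sup)
  show ?thesis
  proof (cases "0 \<le> t")
    case True then show ?thesis by (simp add: nonneg)
  next
    case False
    then have "\<bar>(- t) *\<^sub>R x\<bar> = (- t) *\<^sub>R \<bar>x\<bar>" by (intro nonneg) simp
    then show ?thesis using False by simp
  qed
qed

lemma le_pprt: "x \<le> pprt (x::'e::banach_lattice)"
  by (simp add: pprt_def)

lemma pprt_least: "x \<le> z \<Longrightarrow> 0 \<le> z \<Longrightarrow> pprt x \<le> (z::'e::banach_lattice)"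
  by (simp add: pprt_def)

lemma pprt_add_le: "pprt (x + y) \<le> pprt x + pprt (y::'e::banach_lattice)"
  by (rule pprt_least) (simp_all add: add_mono le_pprt)

lemma pprt_minus_pprt_neg: "pprt x - pprt (- x) = (x::'e::banach_lattice)"
  by (simp only: pprt_neg diff_minus_eq_add prts[symmetric])

lemma norm_mono_nonneg: "0 \<le> x \<Longrightarrow> x \<le> y \<Longrightarrow> norm x \<le> norm (y::'e::banach_lattice)"
  using norm_le_of_abs_le[of x y] order_trans[of 0 x y] by simp

lemma norm_pprt_le: "norm (pprt x) \<le> norm (x::'e::banach_lattice)"
  using norm_mono_nonneg[OF zero_le_pprt pprt_least[OF abs_ge_self abs_ge_zero], of x]
  by (simp only: norm_abs_bl)

text \<open>
  The positive cone is closed because \<open>pprt (- l) \<le> pprt (x n - l)\<close> whenever \<open>x n \<ge> 0\<close>, and the norm is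
  monotone on the cone.
\<close>

lemma nonneg_limit:
  fixes x :: "nat \<Rightarrow> 'e::banach_lattice"
  assumes "x \<longlonglongrightarrow> l" "\<And>n. 0 \<le> x n"
  shows "0 \<le> l"
proof -
  have "norm (pprt (- l)) \<le> norm (x n - l)" for n
  proof -
    have "pprt (- l) \<le> pprt (x n - l)" using assms(2)[of n] by simp
    then have "norm (pprt (- l)) \<le> norm (pprt (x n - l))" by (simp add: norm_mono_nonneg)
    then show ?thesis using norm_pprt_le order_trans by blast
  qed
  moreover have "(\<lambda>n. norm (x n - l)) \<longlonglongrightarrow> 0"
    using assms(1) by (simp add: LIM_zero tendsto_norm_zero)
  ultimately have "norm (pprt (- l)) \<le> 0" by (intro LIMSEQ_le_const) auto
  then show ?thesis by (simp add: le_zero_iff_zero_pprt[symmetric])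
qed

lemma nonneg_blinfun_iff: "0 \<le> f \<longleftrightarrow> (\<forall>x\<ge>0. 0 \<le> blinfun_apply (f :: 'e::banach_lattice \<Rightarrow>\<^sub>L real) x)"
  by (simp add: less_eq_blinfun_def zero_blinfun.rep_eq)

lemma nonneg_blinfun_mono:
  "0 \<le> f \<Longrightarrow> x \<le> y \<Longrightarrow> blinfun_apply (f :: 'e::banach_lattice \<Rightarrow>\<^sub>L real) x \<le> f y"
  using nonneg_blinfun_iff[of f] blinfun.diff_right[of f y x]
  by (metis diff_ge_0_iff_ge)

lemma blinfun_of_linear_le_norm:
  fixes g :: "'e::real_normed_vector \<Rightarrow> real"
  assumes "linear g" "\<And>x. g x \<le> norm x"
  obtains h :: "'e \<Rightarrow>\<^sub>L real" where "\<And>x. blinfun_apply h x = g x"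
proof
  have "\<bar>g x\<bar> \<le> norm x" for x
    using assms(2)[of x] assms(2)[of "- x"] linear_neg[OF assms(1), of x] by simp
  then have "bounded_linear g"
    using assms(1) by (intro bounded_linear_intro[where K = 1])
      (simp_all add: linear_add linear_scale)
  then show "blinfun_apply (Blinfun g) x = g x" for x by (simp add: bounded_linear_Blinfun_apply)
qed

text \<open>
  Hahn-Banach is applied to \<open>x \<mapsto> norm (pprt x)\<close> instead of the norm: a linear function below it is
  nonpositive on the negative cone, so the norming functional comes out positive.
\<close>

lemma positive_norming_functional:
  fixes x\<^sub>0 :: "'e::banach_lattice"
  assumes "0 \<le> x\<^sub>0"
  obtains g :: "'e \<Rightarrow>\<^sub>L real" where "0 \<le> g" "\<And>x. blinfun_apply g x \<le> norm x" "g x\<^sub>0 = norm x\<^sub>0"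
proof -
  have "sublinear (\<lambda>x::'e. norm (pprt x))"
    unfolding sublinear_def
  proof (intro conjI allI impI)
    fix x y :: 'e
    have "norm (pprt (x + y)) \<le> norm (pprt x + pprt y)"
      by (intro norm_mono_nonneg pprt_add_le) simp
    then show "norm (pprt (x + y)) \<le> norm (pprt x) + norm (pprt y)"
      using norm_triangle_ineq order_trans by blast
  qed (simp add: pprt_scaleR)
  then obtain g where g: "linear g" "\<And>x. g x \<le> norm (pprt x)" "g x\<^sub>0 = norm (pprt x\<^sub>0)"
    using hahn_banach_sublinear by metis
  obtain h :: "'e \<Rightarrow>\<^sub>L real" where h: "\<And>x. blinfun_apply h x = g x"
    using blinfun_of_linear_le_norm[OF g(1)] g(2) norm_pprt_le order_trans by metis
  show thesis
  proof (rule that[of h])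
    show "0 \<le> h"
      unfolding nonneg_blinfun_iff
    proof (intro allI impI)
      fix x :: 'e assume "0 \<le> x"
      then have "pprt (- x) = 0" by simp
      then show "0 \<le> blinfun_apply h x"
        using g(2)[of "- x"] linear_neg[OF g(1), of x] by (simp add: h del: pprt_eq_0)
    qed
    show "blinfun_apply h x \<le> norm x" for x
      unfolding h using g(2) norm_pprt_le by (rule order_trans)
    show "blinfun_apply h x\<^sub>0 = norm x\<^sub>0"
      using g(3) assms by (simp add: h)
  qed
qed

section \<open>The modulus of a functional\<close>

lemma riesz_decomposition:
  fixes y :: "'e::banach_lattice"
  assumes "\<bar>y\<bar> \<le> a + b" "0 \<le> a" "0 \<le> b"
  obtains y\<^sub>1 y\<^sub>2 where "y = y\<^sub>1 + y\<^sub>2" "\<bar>y\<^sub>1\<bar> \<le> a" "\<bar>y\<^sub>2\<bar> \<le> b"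
proof
  \<comment> \<open>Truncate \<open>y\<close> to the order interval from \<open>- a\<close> to \<open>a\<close>.\<close>
  define z where "z = sup (- a) (inf y a)"
  have y: "y \<le> a + b" "- y \<le> a + b"
    using assms(1) abs_ge_self abs_ge_minus_self order_trans by blast+
  have "- a \<le> z" "z \<le> a"
    using assms(2) by (auto simp: z_def intro: order_trans[of _ 0])
  then show "\<bar>z\<bar> \<le> a" by (auto intro: abs_leI simp: minus_le_iff)
  have "y - b \<le> inf y a" using y(1) assms(3) by (simp add: diff_le_eq)
  then have "y - b \<le> z" unfolding z_def by (rule le_supI2)
  moreover have "z \<le> y + b"
  proof -
    have "- a \<le> y + b"
    proof -
      have "- (a + b) \<le> y" using y(2) by (simp only: minus_le_iff)
      from add_right_mono[OF this, of b] show ?thesis by simp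
    qed
    moreover have "inf y a \<le> y + b" using assms(3) by (intro le_infI1) simp
    ultimately show ?thesis by (simp add: z_def)
  qed
  ultimately show "\<bar>y - z\<bar> \<le> b" by (intro abs_leI) (simp_all add: diff_le_eq add.commute)
  show "y = z + (y - z)" by simp
qed

text \<open>
  Riesz-Kantorovich: on the positive cone the modulus is \<open>m x = sup {f y | \<bar>y\<bar> \<le> x}\<close>, additive by the
  decomposition property, and an additive function on the cone extends linearly to differences.
\<close>

theorem modulus_functional_exists:
  fixes f :: "'e::banach_lattice \<Rightarrow>\<^sub>L real"
  obtains h where "isLub UNIV {f, - f} h"
proof -
  define S where "S x = {blinfun_apply f y | y. \<bar>y\<bar> \<le> x}" for x
  define m where "m x = Sup (S x)" for x
  have bound: "c \<le> norm f * norm x" if c: "c \<in> S x" for c x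
  proof -
    obtain y where y: "\<bar>y\<bar> \<le> x" "c = blinfun_apply f y" using c by (auto simp: S_def)
    have "norm y \<le> norm x"
      using norm_mono_nonneg[OF abs_ge_zero y(1)] by (simp add: norm_abs_bl)
    then have "norm f * norm y \<le> norm f * norm x" by (intro mult_left_mono) simp_all
    with norm_blinfun[of f y] y show ?thesis by simp
  qed
  have bdd: "bdd_above (S x)" for x using bound by (intro bdd_aboveI) blast
  have zero: "0 \<in> S x" if "0 \<le> x" for x
    using that by (auto simp: S_def intro!: exI[of _ 0] simp: blinfun.zero_right)
  have upper: "blinfun_apply f y \<le> m x" if "\<bar>y\<bar> \<le> x" for x y
    unfolding m_def using that by (intro cSup_upper bdd) (auto simp: S_def)
  have least: "m x \<le> c" if "0 \<le> x" "\<And>y. \<bar>y\<bar> \<le> x \<Longrightarrow> blinfun_apply f y \<le> c" for x c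
    unfolding m_def using zero[OF that(1)] that(2) by (intro cSup_least) (auto simp: S_def)
  have m_add: "m (a + b) = m a + m b" if ab: "0 \<le> a" "0 \<le> b" for a b
  proof (rule order.antisym)
    show "m (a + b) \<le> m a + m b"
    proof (rule least)
      fix y assume "\<bar>y\<bar> \<le> a + b"
      then obtain y\<^sub>1 y\<^sub>2 where "y = y\<^sub>1 + y\<^sub>2" "\<bar>y\<^sub>1\<bar> \<le> a" "\<bar>y\<^sub>2\<bar> \<le> b"
        using riesz_decomposition ab by blast
      then show "blinfun_apply f y \<le> m a + m b" by (simp add: blinfun.add_right add_mono upper)
    qed (use ab in simp)
    have "m a \<le> m (a + b) - blinfun_apply f y" if y: "\<bar>y\<bar> \<le> b" for y
    proof (rule least[OF ab(1)])
      fix x assume "\<bar>x\<bar> \<le> a"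
      with y have "\<bar>x + y\<bar> \<le> a + b" by (meson abs_triangle_ineq add_mono order_trans)
      from upper[OF this] show "blinfun_apply f x \<le> m (a + b) - blinfun_apply f y"
        by (simp add: blinfun.add_right)
    qed
    then have "m b \<le> m (a + b) - m a" by (intro least ab) (simp add: le_diff_eq algebra_simps)
    then show "m a + m b \<le> m (a + b)" by simp
  qed
  have m_scale_le: "m (t *\<^sub>R a) \<le> t * m a" if "0 < t" "0 \<le> a" for t a
  proof (rule least)
    fix y assume "\<bar>y\<bar> \<le> t *\<^sub>R a"
    from scaleR_left_mono[OF this, of "1 / t"] have "\<bar>(1 / t) *\<^sub>R y\<bar> \<le> a"
      using that by (simp add: abs_scaleR)
    from upper[OF this] show "blinfun_apply f y \<le> t * m a"
      using that by (simp add: blinfun.scaleR_right field_simps)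
  qed (use that in \<open>simp add: scaleR_nonneg_nonneg\<close>)
  have m_scale: "m (t *\<^sub>R a) = t * m a" if t: "0 < t" and a: "0 \<le> a" for t a
  proof (rule order.antisym[OF m_scale_le[OF that]])
    have "m ((1 / t) *\<^sub>R (t *\<^sub>R a)) \<le> 1 / t * m (t *\<^sub>R a)"
      using that by (intro m_scale_le) (simp_all add: scaleR_nonneg_nonneg)
    then show "t * m a \<le> m (t *\<^sub>R a)" using t by (simp add: field_simps)
  qed
  have m_nonneg: "0 \<le> m a" if "0 \<le> a" for a
    using upper[of 0 a] that by (simp add: blinfun.zero_right)
  have m_le: "m a \<le> norm f * norm a" if "0 \<le> a" for a
    unfolding m_def using zero[OF that] bound by (intro cSup_least) auto
  define H where "H x = m (pprt x) - m (pprt (- x))" for x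
  have H_add: "H (x + y) = H x + H y" for x y
  proof -
    have "pprt (x + y) + (pprt (- x) + pprt (- y)) = pprt x + pprt y + pprt (- (x + y))"
    proof -
      have eq: "pprt z = z + pprt (- z)" for z :: 'e
        using pprt_minus_pprt_neg[of z] by (simp only: diff_eq_eq)
      show ?thesis by (simp only: eq[of x] eq[of y] eq[of "x + y"] ac_simps)
    qed
    then have "m (pprt (x + y) + (pprt (- x) + pprt (- y))) = m (pprt x + pprt y + pprt (- (x + y)))"
      by (rule arg_cong)
    then have "m (pprt (x + y)) + (m (pprt (- x)) + m (pprt (- y)))
        = m (pprt x) + m (pprt y) + m (pprt (- (x + y)))"
      by (simp only: m_add add_nonneg_nonneg zero_le_pprt)
    then show ?thesis by (simp add: H_def)
  qed
  have H_neg: "H (- x) = - H x" for x by (simp add: H_def)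
  have m_zero: "m 0 = 0" using m_add[of 0 0] by simp
  have H_pos: "H (t *\<^sub>R x) = t * H x" if "0 < t" for t x
  proof -
    have "H (t *\<^sub>R x) = m (t *\<^sub>R pprt x) - m (t *\<^sub>R pprt (- x))"
      using that by (simp add: H_def pprt_scaleR flip: scaleR_minus_right)
    then show ?thesis using that by (simp add: m_scale H_def right_diff_distrib)
  qed
  have H_scale: "H (t *\<^sub>R x) = t *\<^sub>R H x" for t x
    using H_pos[of t x] H_pos[of "- t" x] H_neg[of "t *\<^sub>R x"]
    by (cases t "0::real" rule: linorder_cases) (auto simp: H_def m_zero)
  have "\<bar>H x\<bar> \<le> norm x * (2 * norm f)" for x
  proof -
    have "\<bar>H x\<bar> \<le> m (pprt x) + m (pprt (- x))"
      unfolding H_def using m_nonneg[of "pprt x"] m_nonneg[of "pprt (- x)"] by simp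
    also have "\<dots> \<le> norm f * norm (pprt x) + norm f * norm (pprt (- x))"
      by (intro add_mono m_le) simp_all
    also have "\<dots> \<le> norm f * norm x + norm f * norm x"
      using norm_pprt_le[of x] norm_pprt_le[of "- x"] by (intro add_mono mult_left_mono) simp_all
    finally show ?thesis by simp
  qed
  then have "bounded_linear H" by (intro bounded_linear_intro H_add H_scale) simp
  then have apply_H: "blinfun_apply (Blinfun H) = H" by (rule bounded_linear_Blinfun_apply)
  have on_cone: "H x = m x" if "0 \<le> x" for x
    using that by (simp add: H_def m_zero)
  have "Blinfun H \<le> k" if k: "f \<le> k" "- f \<le> k" for k
    unfolding less_eq_blinfun_def apply_H
  proof (intro allI impI)
    fix x :: 'e assume x: "0 \<le> x"
    have kf: "blinfun_apply f z \<le> k z" "- blinfun_apply f z \<le> k z" if "0 \<le> z" for z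
      using k that by (auto simp: less_eq_blinfun_def blinfun.minus_left)
    have k_pos: "0 \<le> k"
      unfolding nonneg_blinfun_iff
    proof (intro allI impI)
      fix z :: 'e assume "0 \<le> z"
      then show "0 \<le> blinfun_apply k z" using kf[of z] by simp
    qed
    have "m x \<le> blinfun_apply k x"
    proof (rule least[OF x])
      fix y assume y: "\<bar>y\<bar> \<le> x"
      have "f y = blinfun_apply f (pprt y) + - blinfun_apply f (pprt (- y))"
        by (metis add_uminus_conv_diff blinfun.diff_right pprt_minus_pprt_neg)
      also have "\<dots> \<le> k (pprt y) + k (pprt (- y))" by (intro add_mono kf) simp_all
      also have "\<dots> = k \<bar>y\<bar>" by (simp add: abs_prts pprt_neg blinfun.diff_right blinfun.minus_right)
      also have "\<dots> \<le> k x" by (rule nonneg_blinfun_mono[OF k_pos y])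
      finally show "blinfun_apply f y \<le> k x" .
    qed
    then show "H x \<le> k x" by (simp add: on_cone[OF x])
  qed
  moreover have "f \<le> Blinfun H" "- f \<le> Blinfun H"
    unfolding less_eq_blinfun_def apply_H
  proof (safe)
    fix x :: 'e assume x: "0 \<le> x"
    show "blinfun_apply f x \<le> H x" using x upper[of x x] by (simp add: on_cone)
    show "blinfun_apply (- f) x \<le> H x"
      using x upper[of "- x" x] by (simp add: on_cone blinfun.minus_left blinfun.minus_right)
  qed
  ultimately have "isLub UNIV {f, - f} (Blinfun H)"
    by (auto simp: isLub_def leastP_def isUb_def setle_def setge_def)
  then show thesis by (rule that)
qed

lemma le_modulus_functional:
  fixes f :: "'e::banach_lattice \<Rightarrow>\<^sub>L real"
  shows "f \<le> modulus_in UNIV f" "- f \<le> modulus_in UNIV f"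
proof -
  obtain h where h: "isLub UNIV {f, - f} h" by (rule modulus_functional_exists)
  then have "modulus_in UNIV f = h" unfolding modulus_in_def by (rule sup_in_eq)
  with h show "f \<le> modulus_in UNIV f" "- f \<le> modulus_in UNIV f"
    by (auto simp: isLub_def leastP_def isUb_def setle_def)
qed

lemma modulus_functional_nonneg: "0 \<le> modulus_in UNIV (f :: 'e::banach_lattice \<Rightarrow>\<^sub>L real)"
  unfolding nonneg_blinfun_iff
proof (intro allI impI)
  fix x :: 'e assume "0 \<le> x"
  then have "blinfun_apply f x \<le> modulus_in UNIV f x" "- blinfun_apply f x \<le> modulus_in UNIV f x"
    using le_modulus_functional[of f] by (auto simp: less_eq_blinfun_def blinfun.minus_left)
  then show "0 \<le> blinfun_apply (modulus_in UNIV f) x" by simp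
qed

section \<open>Absolutely weakly null sequences\<close>

lemma abs_seminorm_nonneg: "0 \<le> abs_seminorm f x"
  using modulus_functional_nonneg[of f] by (simp add: abs_seminorm_def nonneg_blinfun_iff)

lemma abs_seminorm_mono: "\<bar>x\<bar> \<le> \<bar>y\<bar> \<Longrightarrow> abs_seminorm f x \<le> abs_seminorm f y"
  unfolding abs_seminorm_def by (rule nonneg_blinfun_mono[OF modulus_functional_nonneg])

lemma abs_seminorm_diff_le: "abs_seminorm f (x - y) \<le> abs_seminorm f x + abs_seminorm f y"
proof -
  have "\<bar>x - y\<bar> \<le> \<bar>x\<bar> + \<bar>y\<bar>" by (rule abs_triangle_ineq4)
  then show ?thesis
    unfolding abs_seminorm_def
    using nonneg_blinfun_mono[OF modulus_functional_nonneg] blinfun.add_right by metis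
qed

lemma abs_seminorm_minus: "abs_seminorm f (- x) = abs_seminorm f x"
  by (simp add: abs_seminorm_def)

lemma abs_seminorm_scaleR: "abs_seminorm f (c *\<^sub>R x) = \<bar>c\<bar> * abs_seminorm f x"
  by (simp add: abs_seminorm_def abs_scaleR blinfun.scaleR_right)

text \<open>
  Splitting \<open>x\<close> into positive and negative part reduces this to \<open>\<plusminus> f \<le> \<bar>f\<bar>\<close> on the cone. It lets absolute
  weak nullity imply weak nullity.
\<close>

lemma blinfun_le_abs_seminorm: "\<bar>blinfun_apply f x\<bar> \<le> abs_seminorm f x"
proof -
  let ?h = "modulus_in UNIV f"
  have cone: "blinfun_apply f z \<le> ?h z" "- blinfun_apply f z \<le> ?h z" if "0 \<le> z" for z
    using le_modulus_functional[of f] that by (auto simp: less_eq_blinfun_def blinfun.minus_left)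
  have f: "f x = blinfun_apply f (pprt x) - blinfun_apply f (pprt (- x))"
    by (metis blinfun.diff_right pprt_minus_pprt_neg)
  have "abs_seminorm f x = ?h (pprt x) + ?h (pprt (- x))"
    by (simp add: abs_seminorm_def abs_prts pprt_neg blinfun.diff_right blinfun.minus_right)
  then show ?thesis using f cone[of "pprt x"] cone[of "pprt (- x)"] by simp
qed

text \<open>
  The subbasis of the topology contains balls with arbitrary centres; a ball that contains \<open>0\<close> contains,
  by the triangle inequality for \<open>abs_seminorm f\<close>, a ball with the same \<open>f\<close> centred at \<open>0\<close>.
\<close>

lemma absolutely_weakly_null_iff:
  fixes x :: "nat \<Rightarrow> 'e::banach_lattice"
  shows "absolutely_weakly_null x \<longleftrightarrow> (\<forall>f. (\<lambda>n. abs_seminorm f (x n)) \<longlonglongrightarrow> 0)"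
proof
  assume x: "absolutely_weakly_null x"
  show "\<forall>f. (\<lambda>n. abs_seminorm f (x n)) \<longlonglongrightarrow> 0"
  proof
    fix f :: "'e \<Rightarrow>\<^sub>L real"
    have "\<forall>\<^sub>F n in sequentially. abs_seminorm f (x n) < e" if e: "0 < e" for e
    proof -
      have "openin absolute_weak_topology {y. abs_seminorm f (y - 0) < e}"
        unfolding absolute_weak_topology_def using e by (intro topology_generated_by_Basis) blast
      moreover have "0 \<in> {y. abs_seminorm f (y - 0) < e}"
        using e by (simp add: abs_seminorm_def blinfun.zero_right)
      ultimately have "\<forall>\<^sub>F n in sequentially. x n \<in> {y. abs_seminorm f (y - 0) < e}"
        using x unfolding absolutely_weakly_null_def limitin_def by blast
      then show ?thesis by simp
    qed
    then show "(\<lambda>n. abs_seminorm f (x n)) \<longlonglongrightarrow> 0"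
      by (intro tendstoI) (simp add: abs_seminorm_nonneg)
  qed
next
  assume x: "\<forall>f. (\<lambda>n. abs_seminorm f (x n)) \<longlonglongrightarrow> 0"
  let ?S = "{{y. abs_seminorm f (y - a) < \<epsilon>} | f a \<epsilon>. 0 < \<epsilon>} :: 'e set set"
  have ev: "0 \<in> U \<longrightarrow> (\<forall>\<^sub>F n in sequentially. x n \<in> U)" if "generate_topology_on ?S U" for U
    using that
  proof induction
    case (Int U V)
    then show ?case by (auto intro: eventually_conj)
  next
    case (UN K)
    show ?case
    proof
      assume "0 \<in> \<Union>K"
      then obtain V where V: "V \<in> K" "0 \<in> V" by blast
      with UN have "\<forall>\<^sub>F n in sequentially. x n \<in> V" by blast
      then show "\<forall>\<^sub>F n in sequentially. x n \<in> \<Union>K" using V by (auto elim: eventually_mono)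
    qed
  next
    case (Basis U)
    then obtain f a \<epsilon> where U: "U = {y. abs_seminorm f (y - a) < \<epsilon>}" by auto
    show ?case
    proof
      assume "0 \<in> U"
      then have "abs_seminorm f a < \<epsilon>" using U abs_seminorm_minus[of f a] by simp
      then have "\<forall>\<^sub>F n in sequentially. abs_seminorm f (x n) < \<epsilon> - abs_seminorm f a"
        using x by (intro order_tendstoD) auto
      then show "\<forall>\<^sub>F n in sequentially. x n \<in> U"
      proof (rule eventually_mono)
        fix n assume "abs_seminorm f (x n) < \<epsilon> - abs_seminorm f a"
        then show "x n \<in> U" using abs_seminorm_diff_le[of f "x n" a] by (simp add: U)
      qed
    qed
  qed simp
  have "0 \<in> topspace (absolute_weak_topology :: 'e topology)"
  proof -
    have "0 \<in> {y. abs_seminorm 0 (y - 0) < 1}"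
      by (simp add: abs_seminorm_def blinfun.zero_right)
    moreover have "{y. abs_seminorm 0 (y - 0) < 1} \<in> ?S"
      by (intro CollectI exI[of _ 0] exI[of _ 1]) simp
    ultimately show ?thesis
      unfolding absolute_weak_topology_def topology_generated_by_topspace by blast
  qed
  then show "absolutely_weakly_null x"
    unfolding absolutely_weakly_null_def limitin_def absolute_weak_topology_def
      openin_topology_generated_by_iff using ev by blast
qed

lemma absolutely_weakly_null_subseq:
  "absolutely_weakly_null x \<Longrightarrow> strict_mono r \<Longrightarrow> absolutely_weakly_null (x \<circ> r)"
  unfolding absolutely_weakly_null_iff
proof
  fix f
  assume "\<forall>f. (\<lambda>n. abs_seminorm f (x n)) \<longlonglongrightarrow> 0" "strict_mono r"
  then have "((\<lambda>n. abs_seminorm f (x n)) \<circ> r) \<longlonglongrightarrow> 0" by (intro LIMSEQ_subseq_LIMSEQ) auto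
  then show "(\<lambda>n. abs_seminorm f ((x \<circ> r) n)) \<longlonglongrightarrow> 0" by (simp add: o_def)
qed

lemma absolutely_weakly_null_dominated:
  assumes "absolutely_weakly_null x" "\<And>n. \<bar>y n\<bar> \<le> \<bar>c *\<^sub>R x n\<bar>"
  shows "absolutely_weakly_null y"
  unfolding absolutely_weakly_null_iff
proof
  fix f
  show "(\<lambda>n. abs_seminorm f (y n)) \<longlonglongrightarrow> 0"
  proof (rule tendsto_sandwich)
    show "\<forall>\<^sub>F n in sequentially. 0 \<le> abs_seminorm f (y n)" by (simp add: abs_seminorm_nonneg)
    show "\<forall>\<^sub>F n in sequentially. abs_seminorm f (y n) \<le> \<bar>c\<bar> * abs_seminorm f (x n)"
      using abs_seminorm_mono[OF assms(2)] by (simp add: abs_seminorm_scaleR)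
    show "(\<lambda>n. \<bar>c\<bar> * abs_seminorm f (x n)) \<longlonglongrightarrow> 0"
      using assms(1) by (intro tendsto_mult_right_zero) (simp add: absolutely_weakly_null_iff)
  qed simp
qed

text \<open>
  On positive sequences \<open>abs_seminorm f\<close> is the value of a functional, so the two notions of nullity agree.
\<close>

lemma absolutely_weakly_null_nonneg_iff:
  assumes "\<And>n. 0 \<le> x n"
  shows "absolutely_weakly_null x \<longleftrightarrow> weakly_null x"
proof
  assume "weakly_null x"
  then show "absolutely_weakly_null x"
    using assms by (simp add: weakly_null_def absolutely_weakly_null_iff abs_seminorm_def)
next
  assume x: "absolutely_weakly_null x"
  show "weakly_null x"
    unfolding weakly_null_def
  proof
    fix f :: "'a \<Rightarrow>\<^sub>L real"
    show "(\<lambda>n. blinfun_apply f (x n)) \<longlonglongrightarrow> 0"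
    proof (rule Lim_null_comparison)
      show "(\<lambda>n. abs_seminorm f (x n)) \<longlonglongrightarrow> 0" using x unfolding absolutely_weakly_null_iff by (rule spec)
      show "\<forall>\<^sub>F n in sequentially. norm (blinfun_apply f (x n)) \<le> abs_seminorm f (x n)"
        unfolding real_norm_def by (intro always_eventually allI blinfun_le_abs_seminorm)
    qed
  qed
qed

text \<open>
  For positive sequences weak nullity can be tested on the moduli of functionals. Being positive, these are
  monotone, so smaller positive sequences are weakly null as well.
\<close>

lemma weakly_null_dominated:
  assumes "weakly_null x" "\<And>n. 0 \<le> y n" "\<And>n. y n \<le> x n"
  shows "weakly_null y"
proof -
  have x: "0 \<le> x n" for n using assms(2,3) by (rule order_trans)
  have "\<bar>y n\<bar> \<le> \<bar>1 *\<^sub>R x n\<bar>" for n using assms x by simp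
  then have "absolutely_weakly_null y"
    using assms(1) x absolutely_weakly_null_nonneg_iff[of x] absolutely_weakly_null_dominated
    by blast
  then show ?thesis using assms(2) by (simp add: absolutely_weakly_null_nonneg_iff)
qed

section \<open>Extracting disjoint sequences\<close>

text \<open>
  The element \<open>w\<close> below is a small positive multiple of the infimum that lies under both the positive and the
  negative part of \<open>a\<close>. Then \<open>pprt a - w\<close> still majorises \<open>a\<close> and \<open>0\<close>, which forces \<open>w \<le> 0\<close>.
\<close>

lemma inf_pprt_eq_0:
  fixes a b :: "'e::banach_lattice"
  assumes "0 \<le> t" "b \<le> - (t *\<^sub>R a)"
  shows "inf (pprt a) (pprt b) = 0"
proof -
  define s where "s = 1 + t"
  have s: "0 < s" "1 \<le> s" "t \<le> s" using assms(1) by (auto simp: s_def)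
  have "pprt b \<le> pprt (t *\<^sub>R (- a))" using assms(2) by simp
  also have "\<dots> = t *\<^sub>R pprt (- a)" using assms(1) by (rule pprt_scaleR)
  also have "\<dots> \<le> s *\<^sub>R pprt (- a)" using s by (simp add: scaleR_right_mono)
  finally have b: "pprt b \<le> s *\<^sub>R pprt (- a)" .
  have a: "pprt a \<le> s *\<^sub>R pprt a" using scaleR_right_mono[OF s(2), of "pprt a"] by simp
  define w where "w = (1 / s) *\<^sub>R inf (pprt a) (pprt b)"
  have "w \<le> (1 / s) *\<^sub>R (s *\<^sub>R pprt a)"
    unfolding w_def by (intro scaleR_left_mono le_infI1[OF a]) (use s in simp)
  moreover have "w \<le> (1 / s) *\<^sub>R (s *\<^sub>R pprt (- a))"
    unfolding w_def by (intro scaleR_left_mono le_infI2[OF b]) (use s in simp)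
  ultimately have w: "w \<le> pprt a" "w \<le> pprt (- a)" using s by simp_all
  have "pprt a \<le> pprt a - w"
  proof (rule pprt_least)
    have "pprt a - pprt (- a) \<le> pprt a - w" using w(2) by (rule diff_left_mono)
    then show "a \<le> pprt a - w" by (simp only: pprt_minus_pprt_neg)
    show "0 \<le> pprt a - w" using w(1) by simp
  qed
  then have "w \<le> 0" by (simp add: le_diff_eq)
  then have "s *\<^sub>R w \<le> s *\<^sub>R 0" using s by (intro scaleR_left_mono) simp_all
  then have "inf (pprt a) (pprt b) \<le> 0" using s by (simp add: w_def)
  then show ?thesis by (rule order.antisym) simp
qed

lemma member_le_sum_nonneg:
  fixes x :: "'b \<Rightarrow> 'a::ordered_comm_monoid_add"
  assumes "finite A" "j \<in> A" "\<And>i. 0 \<le> x i"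
  shows "x j \<le> (\<Sum>i\<in>A. x i)"
  using sum_mono2[of A "{j}" x] assms by simp

text \<open>
  The common core of the two constructions below. For \<open>j < k\<close>, the \<open>k\<close>-th term is at most
  \<open>(x k - c k x j)\<^sup>+\<close> and the \<open>j\<close>-th term at most \<open>(x j - x k / c k)\<^sup>+\<close>: the positive and, up to a factor, the
  negative part of one element.
\<close>

lemma disjoint_truncations:
  fixes x :: "nat \<Rightarrow> 'e::banach_lattice"
  assumes x: "\<And>n. 0 \<le> x n" and v: "\<And>n. 0 \<le> v n" and c: "\<And>n. 0 < c n"
    and xv: "\<And>j k. j < k \<Longrightarrow> x k \<le> c k *\<^sub>R v j"
  shows "disjoint_sequence (\<lambda>k. pprt (x k - c k *\<^sub>R (\<Sum>i<k. x i) - v k))"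
proof -
  define y where "y k = x k - c k *\<^sub>R (\<Sum>i<k. x i) - v k" for k
  have disj: "inf (pprt (y j)) (pprt (y k)) = 0" if jk: "j < k" for j k
  proof -
    have sum: "0 \<le> (\<Sum>i<n. x i)" for n by (intro sum_nonneg x)
    have "x j \<le> (\<Sum>i<k. x i)" using jk x by (intro member_le_sum_nonneg) auto
    then have "c k *\<^sub>R x j \<le> c k *\<^sub>R (\<Sum>i<k. x i)" using c[of k] by (intro scaleR_left_mono) auto
    then have "y k \<le> x k - c k *\<^sub>R x j - 0" unfolding y_def by (intro diff_mono v) simp_all
    then have yk: "y k \<le> x k - c k *\<^sub>R x j" by simp
    have "(1 / c k) *\<^sub>R x k \<le> (1 / c k) *\<^sub>R (c k *\<^sub>R v j)"
      using xv[OF jk] c[of k] by (intro scaleR_left_mono) auto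
    then have vj: "(1 / c k) *\<^sub>R x k \<le> v j" using c[of k] by simp
    have "0 \<le> c j *\<^sub>R (\<Sum>i<j. x i)" using c[of j] sum by (intro scaleR_nonneg_nonneg) auto
    then have "y j \<le> x j - 0 - (1 / c k) *\<^sub>R x k" unfolding y_def by (intro diff_mono vj) simp_all
    also have "\<dots> = - ((1 / c k) *\<^sub>R (x k - c k *\<^sub>R x j))"
      using c[of k] by (simp add: scaleR_diff_right)
    finally have "inf (pprt (x k - c k *\<^sub>R x j)) (pprt (y j)) = 0"
      using c[of k] by (intro inf_pprt_eq_0[of "1 / c k"]) auto
    moreover have "inf (pprt (y j)) (pprt (y k)) \<le> inf (pprt (x k - c k *\<^sub>R x j)) (pprt (y j))"
      using yk by (simp add: le_infI2)
    ultimately have "inf (pprt (y j)) (pprt (y k)) \<le> 0" by simp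
    then show ?thesis by (rule order.antisym) simp
  qed
  show ?thesis
    unfolding disjoint_sequence_def y_def[symmetric]
  proof (intro allI impI)
    fix j k :: nat assume "j \<noteq> k"
    then show "inf \<bar>pprt (y j)\<bar> \<bar>pprt (y k)\<bar> = 0"
      using disj[of j k] disj[of k j] by (cases j k rule: linorder_cases) (simp_all add: inf_commute)
  qed
qed

text \<open>
  Selection of a subsequence in which the condition on the next index refers to the sum of the terms already
  chosen, while \<open>P\<close> is an invariant of these partial sums that keeps the selection going.
\<close>

lemma greedy_subsequence:
  fixes x :: "nat \<Rightarrow> 'a::comm_monoid_add" and Q :: "nat \<Rightarrow> 'a \<Rightarrow> nat \<Rightarrow> bool"
  assumes P0: "P 0" and step: "\<And>k z N. P z \<Longrightarrow> \<exists>n\<ge>N. Q k z n \<and> P (z + x n)"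
  shows "\<exists>r. strict_mono r \<and> (\<forall>k. Q k (\<Sum>i<k. x (r i)) (r k))"
proof -
  \<comment> \<open>A state consists of the index chosen last and the sum of the terms chosen before it.\<close>
  obtain s where s0: "\<And>k. P (snd (s k) + x (fst (s k))) \<and> Q k (snd (s k)) (fst (s k)) \<and> (k = 0 \<longrightarrow> snd (s k) = 0)"
    and s1: "\<And>k. fst (s k) < fst (s (Suc k)) \<and> snd (s (Suc k)) = snd (s k) + x (fst (s k))"
  proof -
    have "\<exists>s. \<forall>k. (P (snd (s k) + x (fst (s k))) \<and> Q k (snd (s k)) (fst (s k)) \<and> (k = 0 \<longrightarrow> snd (s k) = 0)) \<and>
      (fst (s k) < fst (s (Suc k)) \<and> snd (s (Suc k)) = snd (s k) + x (fst (s k)))"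
    proof (rule dependent_nat_choice)
      show "\<exists>s. P (snd s + x (fst s)) \<and> Q 0 (snd s) (fst s) \<and> ((0::nat) = 0 \<longrightarrow> snd s = 0)"
        using step[OF P0, of 0 0] by (metis fst_conv snd_conv)
    next
      fix s k
      assume "P (snd s + x (fst s)) \<and> Q k (snd s) (fst s) \<and> (k = 0 \<longrightarrow> snd s = 0)"
      then obtain n where "Suc (fst s) \<le> n" "Q (Suc k) (snd s + x (fst s)) n"
          "P (snd s + x (fst s) + x n)"
        using step by blast
      then show "\<exists>t. (P (snd t + x (fst t)) \<and> Q (Suc k) (snd t) (fst t) \<and> (Suc k = 0 \<longrightarrow> snd t = 0)) \<and>
          fst s < fst t \<and> snd t = snd s + x (fst s)"
        by (intro exI[of _ "(n, snd s + x (fst s))"]) simp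
    qed
    then show thesis using that by blast
  qed
  define r where "r k = fst (s k)" for k
  have "snd (s k) = (\<Sum>i<k. x (r i))" for k
    by (induction k) (use s0 s1 in \<open>auto simp: r_def\<close>)
  then have "Q k (\<Sum>i<k. x (r i)) (r k)" for k using s0[of k] by (simp add: r_def)
  moreover have "strict_mono r" using s1 by (simp add: strict_mono_Suc_iff r_def)
  ultimately show ?thesis by blast
qed

lemma weakly_null_subseq:
  fixes x :: "nat \<Rightarrow> 'e::banach_lattice"
  shows "weakly_null x \<Longrightarrow> strict_mono r \<Longrightarrow> weakly_null (\<lambda>k. x (r k))"
  unfolding weakly_null_def
proof
  fix f :: "'e \<Rightarrow>\<^sub>L real"
  assume "\<forall>f :: 'e \<Rightarrow>\<^sub>L real. (\<lambda>n. blinfun_apply f (x n)) \<longlonglongrightarrow> 0" "strict_mono r"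
  then have "((\<lambda>n. blinfun_apply f (x n)) \<circ> r) \<longlonglongrightarrow> 0" by (intro LIMSEQ_subseq_LIMSEQ) auto
  then show "(\<lambda>k. blinfun_apply f (x (r k))) \<longlonglongrightarrow> 0" by (simp add: o_def)
qed

lemma disjoint_truncations_of_weakly_null:
  fixes x :: "nat \<Rightarrow> 'e::banach_lattice"
  assumes "weakly_null x" "\<And>n. 0 \<le> x n" "strict_mono r" and v: "\<And>n. 0 \<le> v n" and c: "\<And>n. 0 < c n"
    and xv: "\<And>j k. j < k \<Longrightarrow> x (r k) \<le> c k *\<^sub>R v j"
  defines "y \<equiv> \<lambda>k. pprt (x (r k) - c k *\<^sub>R (\<Sum>i<k. x (r i)) - v k)"
  shows "disjoint_sequence y" "weakly_null y" "\<And>k. 0 \<le> y k" "\<And>k. y k \<le> x (r k)"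
proof -
  show "disjoint_sequence y"
    unfolding y_def using assms by (intro disjoint_truncations[of "\<lambda>k. x (r k)"]) auto
  show nonneg: "0 \<le> y k" for k by (simp add: y_def)
  show le: "y k \<le> x (r k)" for k
    unfolding y_def
  proof (rule pprt_least)
    have "0 \<le> c k *\<^sub>R (\<Sum>i<k. x (r i))"
      using c[of k] assms(2) by (intro scaleR_nonneg_nonneg sum_nonneg) auto
    then have "x (r k) - c k *\<^sub>R (\<Sum>i<k. x (r i)) - v k \<le> x (r k) - 0 - 0"
      by (intro diff_mono v) auto
    then show "x (r k) - c k *\<^sub>R (\<Sum>i<k. x (r i)) - v k \<le> x (r k)" by simp
  qed (rule assms(2))
  show "weakly_null y"
    by (rule weakly_null_dominated[OF weakly_null_subseq[OF assms(1,3)] nonneg le])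
qed

text \<open>
  If no positive \<open>z\<close> dominates the tail of the sequence up to an error of norm less than \<open>e\<close>, the subsequence can be chosen so that
  subtracting \<open>4 ^ k\<close> times the sum of the earlier terms leaves norm at least \<open>e\<close>. The later terms are cut
  off with \<open>2 ^ (- k) u\<close>, where \<open>u = \<Sum>i. 2 ^ (- i) x (r i)\<close>; this costs a null sequence in norm. The factor
  \<open>4 ^ k\<close> outweighs \<open>2 ^ j\<close> times \<open>2 ^ k\<close> for \<open>j < k\<close>, as disjointness requires.
\<close>

lemma disjoint_subsequence_not_order_dominated:
  fixes x :: "nat \<Rightarrow> 'e::banach_lattice"
  assumes w: "weakly_null x" and x: "\<And>n. 0 \<le> x n" "\<And>n. norm (x n) \<le> 1" and e: "0 < e"
    and freq: "\<And>z. 0 \<le> z \<Longrightarrow> \<exists>\<^sub>F n in sequentially. e \<le> norm (pprt (x n - z))"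
  obtains y :: "nat \<Rightarrow> 'e::banach_lattice" where "disjoint_sequence y" "weakly_null y" "\<And>k. 0 \<le> y k" "\<And>k. norm (y k) \<le> 1"
    "\<not> y \<longlonglongrightarrow> 0"
proof -
  have "\<exists>r. strict_mono r \<and> (\<forall>k. e \<le> norm (pprt (x (r k) - 4 ^ k *\<^sub>R (\<Sum>i<k. x (r i)))))"
  proof (rule greedy_subsequence[where x = x and P = "\<lambda>z. 0 \<le> z"
        and Q = "\<lambda>k z n. e \<le> norm (pprt (x n - 4 ^ k *\<^sub>R z))"])
    show "\<exists>n\<ge>N. e \<le> norm (pprt (x n - 4 ^ k *\<^sub>R z)) \<and> 0 \<le> z + x n" if "0 \<le> z" for k z N
      using freq[of "4 ^ k *\<^sub>R z"] that x(1)
      by (auto simp: frequently_sequentially scaleR_nonneg_nonneg)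
  qed simp
  then obtain r where r: "strict_mono r"
    and norm_r: "\<And>k. e \<le> norm (pprt (x (r k) - 4 ^ k *\<^sub>R (\<Sum>i<k. x (r i))))"
    by blast
  define u where "u = (\<Sum>i. (1 / 2) ^ i *\<^sub>R x (r i))"
  have summ: "summable (\<lambda>i. (1 / 2) ^ i *\<^sub>R x (r i))"
  proof (rule summable_comparison_test')
    show "summable (\<lambda>i. (1 / 2) ^ i :: real)" by (rule summable_geometric) simp
    show "norm ((1 / 2) ^ i *\<^sub>R x (r i)) \<le> (1 / 2) ^ i" if "0 \<le> i" for i
      using x(2)[of "r i"] by (simp add: field_simps)
  qed
  have term_le: "(1 / 2) ^ k *\<^sub>R x (r k) \<le> u" for k
  proof -
    have "(\<lambda>n. (\<Sum>i<n + Suc k. (1 / 2) ^ i *\<^sub>R x (r i)) - (1 / 2) ^ k *\<^sub>R x (r k)) \<longlonglongrightarrow>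
        u - (1 / 2) ^ k *\<^sub>R x (r k)"
      unfolding u_def by (intro tendsto_diff tendsto_const LIMSEQ_ignore_initial_segment summable_LIMSEQ summ)
    then have "0 \<le> u - (1 / 2) ^ k *\<^sub>R x (r k)"
    proof (rule nonneg_limit)
      fix n
      have "(1 / 2) ^ k *\<^sub>R x (r k) \<le> (\<Sum>i<n + Suc k. (1 / 2) ^ i *\<^sub>R x (r i))"
        using x(1) by (intro member_le_sum_nonneg[where x = "\<lambda>i. (1 / 2) ^ i *\<^sub>R x (r i)"])
          (auto intro: scaleR_nonneg_nonneg)
      then show "0 \<le> (\<Sum>i<n + Suc k. (1 / 2) ^ i *\<^sub>R x (r i)) - (1 / 2) ^ k *\<^sub>R x (r k)" by simp
    qed
    then show ?thesis by simp
  qed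
  have u: "0 \<le> u" using term_le[of 0] x(1) order_trans by simp blast
  define v where "v k = (1 / 2) ^ k *\<^sub>R u" for k :: nat
  have v: "0 \<le> v k" for k unfolding v_def using u by (simp add: scaleR_nonneg_nonneg)
  have xv: "x (r k) \<le> 4 ^ k *\<^sub>R v j" if "j < k" for j k :: nat
  proof -
    have "1 *\<^sub>R x (r k) \<le> (4 ^ k * (1 / 2) ^ j * (1 / 2) ^ k :: real) *\<^sub>R x (r k)"
    proof (rule scaleR_right_mono[OF _ x(1)])
      have "(2::real) ^ j \<le> 2 ^ k" using that by (intro power_increasing) auto
      moreover have "(4::real) ^ k * (1 / 2) ^ k = 2 ^ k" by (simp flip: power_mult_distrib)
      ultimately show "(1::real) \<le> 4 ^ k * (1 / 2) ^ j * (1 / 2) ^ k"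
        by (simp add: field_simps)
    qed
    also have "\<dots> = (4 ^ k * (1 / 2) ^ j) *\<^sub>R ((1 / 2) ^ k *\<^sub>R x (r k))" by simp
    also have "\<dots> \<le> (4 ^ k * (1 / 2) ^ j) *\<^sub>R u" by (intro scaleR_left_mono term_le) simp
    finally show ?thesis by (simp add: v_def)
  qed
  define y where "y k = pprt (x (r k) - 4 ^ k *\<^sub>R (\<Sum>i<k. x (r i)) - v k)" for k
  have c: "(0::real) < 4 ^ k" for k :: nat by simp
  note y = disjoint_truncations_of_weakly_null[where x = x and r = r and v = v and c = "\<lambda>k. 4 ^ k", OF w x(1) r v c xv, folded y_def, simplified]
  have "e \<le> norm (y k) + norm (v k)" for k
  proof -
    define a where "a = x (r k) - 4 ^ k *\<^sub>R (\<Sum>i<k. x (r i))"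
    have "pprt a = pprt ((a - v k) + v k)" by simp
    also have "\<dots> \<le> pprt (a - v k) + pprt (v k)" by (rule pprt_add_le)
    also have "\<dots> = y k + v k" by (simp add: y_def a_def v)
    finally have "norm (pprt a) \<le> norm (y k + v k)" by (intro norm_mono_nonneg) simp_all
    then show ?thesis using norm_r[of k] norm_triangle_ineq[of "y k" "v k"] by (simp add: a_def)
  qed
  moreover have "v \<longlonglongrightarrow> 0"
    unfolding v_def using tendsto_scaleR[OF LIMSEQ_realpow_zero[of "1 / 2"] tendsto_const[of u]] by simp
  ultimately have "\<not> y \<longlonglongrightarrow> 0"
  proof (intro notI)
    assume "y \<longlonglongrightarrow> 0"
    then have "(\<lambda>k. norm (y k) + norm (v k)) \<longlonglongrightarrow> 0 + 0"
      using \<open>v \<longlonglongrightarrow> 0\<close> by (intro tendsto_add tendsto_norm_zero)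
    then have "e \<le> 0 + 0" by (rule LIMSEQ_le_const) (use \<open>\<And>k. e \<le> norm (y k) + norm (v k)\<close> in blast)
    then show False using e by simp
  qed
  moreover have "norm (y k) \<le> 1" for k
    using norm_mono_nonneg[OF y(3,4)] x(2) order_trans by blast
  ultimately show thesis by (intro that[of y] y)
qed

text \<open>
  Under an order bound \<open>u\<close> a fixed small multiple \<open>\<eta> u\<close> cuts off all later terms, so the factor for the
  earlier terms can be the constant \<open>1 / \<eta>\<close>. What remains is to make the earlier terms small where the
  current one is large. Size is measured by positive norming functionals \<open>g n\<close> of \<open>x n\<close>. Hahn-Banach below
  the upper limit of the \<open>g n\<close> yields a functional \<open>h\<close> that plays the part of a weak-star cluster point: as
  \<open>h (x n)\<close> tends to \<open>0\<close>, the sums of chosen terms can be kept small under \<open>h\<close>, and then they are small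
  under \<open>g n\<close> for infinitely many \<open>n\<close>.
\<close>

lemma disjoint_subsequence_order_bounded:
  fixes x :: "nat \<Rightarrow> 'e::banach_lattice"
  assumes w: "weakly_null x" and x: "\<And>n. 0 \<le> x n" "\<And>n. norm (x n) \<le> 1" and e: "0 < e"
    and norm_x: "\<And>n. e \<le> norm (x n)" and u: "0 \<le> u" "\<And>n. x n \<le> u"
  obtains y :: "nat \<Rightarrow> 'e::banach_lattice" where "disjoint_sequence y" "weakly_null y" "\<And>k. 0 \<le> y k" "\<And>k. norm (y k) \<le> 1"
    "\<not> y \<longlonglongrightarrow> 0"
proof -
  have "\<exists>g :: 'e \<Rightarrow>\<^sub>L real. 0 \<le> g \<and> (\<forall>z. blinfun_apply g z \<le> norm z) \<and> g (x n) = norm (x n)" for n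
    using positive_norming_functional[OF x(1)] by metis
  then obtain g :: "nat \<Rightarrow> 'e \<Rightarrow>\<^sub>L real" where g_nonneg: "\<And>n. 0 \<le> g n"
    and g_le: "\<And>n z. blinfun_apply (g n) z \<le> norm z" and g_norming: "\<And>n. g n (x n) = norm (x n)"
    by metis
  \<comment> \<open>The sublinear function \<open>Inf (S z)\<close> is the upper limit of \<open>g n z\<close>.\<close>
  define S where "S z = {c. \<forall>\<^sub>F n in sequentially. blinfun_apply (g n) z \<le> c}" for z
  have S_ge: "- norm z \<le> c" if "c \<in> S z" for c z
  proof -
    have "\<forall>\<^sub>F n in sequentially. blinfun_apply (g n) z \<le> c" using that by (simp add: S_def)
    then obtain n where "blinfun_apply (g n) z \<le> c" using eventually_happens by force
    then show ?thesis using g_le[of n "- z"] by (simp add: blinfun.minus_right)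
  qed
  have norm_mem: "norm z \<in> S z" for z by (simp add: S_def g_le)
  have bdd: "bdd_below (S z)" for z using S_ge by (intro bdd_belowI) blast
  have "sublinear (\<lambda>z. Inf (S z))"
  proof (rule sublinear_Inf[OF _ bdd])
    show "S z \<noteq> {}" for z using norm_mem by blast
  next
    fix a b c d assume "c \<in> S a" "d \<in> S b"
    then have "\<forall>\<^sub>F n in sequentially. blinfun_apply (g n) a \<le> c \<and> blinfun_apply (g n) b \<le> d"
      by (simp add: S_def eventually_conj)
    then have "c + d \<in> S (a + b)"
      unfolding S_def by (auto elim!: eventually_mono simp: blinfun.add_right)
    then show "\<exists>e\<in>S (a + b). e \<le> c + d" by blast
  next
    fix t a c assume "0 \<le> (t::real)" "c \<in> S a"
    then have "t * c \<in> S (t *\<^sub>R a)"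
      unfolding S_def by (auto elim!: eventually_mono simp: blinfun.scaleR_right mult_left_mono)
    then show "\<exists>e\<in>S (t *\<^sub>R a). e \<le> t * c" by blast
  qed
  then obtain h where h: "linear h" "\<And>z. h z \<le> Inf (S z)"
    using hahn_banach_sublinear by metis
  have h_le: "h z \<le> c" if "c \<in> S z" for c z
    using h(2)[of z] cInf_lower[OF that bdd] by simp
  obtain G :: "'e \<Rightarrow>\<^sub>L real" where G: "\<And>z. blinfun_apply G z = h z"
    using blinfun_of_linear_le_norm[OF h(1)] h_le[OF norm_mem] by metis
  have G_null: "(\<lambda>n. h (x n)) \<longlonglongrightarrow> 0" using w G by (simp add: weakly_null_def flip: G)
  have h_freq: "\<exists>\<^sub>F n in sequentially. blinfun_apply (g n) z < d" if "h z < d" for z d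
  proof (rule ccontr)
    assume "\<not> ?thesis"
    then have "\<forall>\<^sub>F n in sequentially. d \<le> blinfun_apply (g n) z"
      by (simp add: not_frequently not_less)
    then have "- d \<in> S (- z)" by (simp add: S_def blinfun.minus_right)
    then have "h (- z) \<le> - d" by (rule h_le)
    then show False using that linear_neg[OF h(1), of z] by simp
  qed
  \<comment> \<open>The constants make each of the two subtractions cost at most \<open>e / 4\<close> under \<open>g (r k)\<close>.\<close>
  define \<eta> where "\<eta> = e / (4 * (1 + norm u))"
  have "0 < 1 + norm u" by (simp add: add_pos_nonneg)
  then have \<eta>: "0 < \<eta>" "\<eta> * norm u \<le> e / 4"
    using e by (auto simp: \<eta>_def field_simps)
  define d where "d = e * \<eta> / 4"
  have d: "0 < d" using e \<eta> by (simp add: d_def)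
  have "\<exists>r. strict_mono r \<and> (\<forall>k::nat. blinfun_apply (g (r k)) (\<Sum>i<k. x (r i)) < d)"
  proof (rule greedy_subsequence[where x = x and P = "\<lambda>z. h z < d"
        and Q = "\<lambda>k z n. blinfun_apply (g n) z < d"])
    show "h 0 < d" using d by (simp add: linear_0[OF h(1)])
    fix k z N assume z: "h z < d"
    have "\<forall>\<^sub>F n in sequentially. h (x n) < d - h z"
      using z by (intro order_tendstoD[OF G_null]) simp
    then have "\<exists>\<^sub>F n in sequentially. blinfun_apply (g n) z < d \<and> h (x n) < d - h z \<and> N \<le> n"
      using h_freq[OF z] eventually_ge_at_top[of N]
      by (intro frequently_eventually_frequently eventually_conj)
    then show "\<exists>n\<ge>N. blinfun_apply (g n) z < d \<and> h (z + x n) < d"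
      by (auto dest!: frequently_ex simp: linear_add[OF h(1)])
  qed
  then obtain r :: "nat \<Rightarrow> nat" where r: "strict_mono r"
    and g_r: "\<And>k. blinfun_apply (g (r k)) (\<Sum>i<k. x (r i)) < d"
    by blast
  define v where "v k = \<eta> *\<^sub>R u" for k :: nat
  have v: "0 \<le> v k" for k unfolding v_def using u \<eta> by (simp add: scaleR_nonneg_nonneg)
  have xv: "x (r k) \<le> (1 / \<eta>) *\<^sub>R v j" if "j < k" for j k :: nat
    using u(2) \<eta> by (simp add: v_def)
  define y where "y k = pprt (x (r k) - (1 / \<eta>) *\<^sub>R (\<Sum>i<k. x (r i)) - v k)" for k
  have \<eta>': "0 < 1 / \<eta>" using \<eta> by simp
  note y = disjoint_truncations_of_weakly_null[where x = x and r = r and v = v and c = "\<lambda>_. 1 / \<eta>", OF w x(1) r v \<eta>' xv, folded y_def, simplified]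
  have "e / 2 \<le> norm (y k)" for k
  proof -
    let ?g = "blinfun_apply (g (r k))"
    have "1 / \<eta> * ?g (\<Sum>i<k. x (r i)) \<le> 1 / \<eta> * d"
      using g_r[of k] \<eta> by (intro mult_left_mono) auto
    also have "\<dots> = e / 4" using \<eta> by (simp add: d_def)
    finally have 1: "1 / \<eta> * ?g (\<Sum>i<k. x (r i)) \<le> e / 4" .
    have "\<eta> * ?g u \<le> \<eta> * norm u" using g_le \<eta> by (intro mult_left_mono) auto
    also note \<eta>(2)
    finally have 2: "\<eta> * ?g u \<le> e / 4" .
    have "e / 2 \<le> ?g (x (r k)) - 1 / \<eta> * ?g (\<Sum>i<k. x (r i)) - \<eta> * ?g u"
      using 1 2 norm_x[of "r k"] by (simp add: g_norming)
    also have "\<dots> = ?g (x (r k) - (1 / \<eta>) *\<^sub>R (\<Sum>i<k. x (r i)) - v k)"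
      by (simp add: v_def blinfun.diff_right blinfun.scaleR_right)
    also have "\<dots> \<le> ?g (y k)" unfolding y_def by (intro nonneg_blinfun_mono[OF g_nonneg] le_pprt)
    also have "\<dots> \<le> norm (y k)" by (rule g_le)
    finally show ?thesis .
  qed
  then have "\<not> y \<longlonglongrightarrow> 0"
    using e LIMSEQ_le_const[of "\<lambda>k. norm (y k)" 0 "e / 2"] by (auto dest: tendsto_norm_zero)
  moreover have "norm (y k) \<le> 1" for k
    using norm_mono_nonneg[OF y(3,4)] x(2) order_trans by blast
  ultimately show thesis by (intro that[of y] y)
qed

lemma not_null_subsequence:
  fixes x :: "nat \<Rightarrow> 'a::real_normed_vector"
  assumes "\<not> x \<longlonglongrightarrow> 0"
  obtains r :: "nat \<Rightarrow> nat" and e where "strict_mono r" "0 < e" "\<And>n. e \<le> norm (x (r n))"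
proof -
  obtain e where e: "0 < e" "\<exists>\<^sub>F n in sequentially. e \<le> norm (x n)"
    using assms unfolding tendsto_iff by (auto simp: not_eventually not_less)
  then have "infinite {n. e \<le> norm (x n)}" by (simp add: frequently_cofinite flip: cofinite_eq_sequentially)
  then obtain r :: "nat \<Rightarrow> nat" where "strict_mono r" "\<And>n. r n \<in> {n. e \<le> norm (x n)}"
    using infinite_enumerate by blast
  then show thesis using that e(1) by blast
qed

text \<open>
  Shrinking each positive term to norm at most \<open>1\<close> preserves weak nullity by domination, so the sequence may
  be taken bounded. If some positive \<open>z\<close> dominates the tail up to a small error in norm, truncation at \<open>z\<close>
  loses little norm and makes the sequence order bounded; otherwise the sequence itself can be disjointified.
\<close>

theorem positive_disjoint_weakly_null_exists:
  assumes "\<not> positive_schur_property TYPE('e::banach_lattice)"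
  obtains y :: "nat \<Rightarrow> 'e::banach_lattice" where "disjoint_sequence y" "weakly_null y" "\<And>k. 0 \<le> y k"
    "\<And>k. norm (y k) \<le> 1" "\<not> y \<longlonglongrightarrow> 0"
proof -
  obtain x\<^sub>0 :: "nat \<Rightarrow> 'e" where x0: "\<And>n. 0 \<le> x\<^sub>0 n" "weakly_null x\<^sub>0" "\<not> x\<^sub>0 \<longlonglongrightarrow> 0"
    using assms unfolding positive_schur_property_def by blast
  obtain r :: "nat \<Rightarrow> nat" and e0 where r: "strict_mono r" "0 < e0" "\<And>n. e0 \<le> norm (x\<^sub>0 (r n))"
    using not_null_subsequence[OF x0(3)] by blast
  define e where "e = min e0 1"
  define t where "t n = 1 / max 1 (norm (x\<^sub>0 (r n)))" for n
  define x where "x n = t n *\<^sub>R x\<^sub>0 (r n)" for n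
  have t: "0 \<le> t n" "t n \<le> 1" for n by (auto simp: t_def)
  have x: "0 \<le> x n" for n using t x0 by (simp add: x_def scaleR_nonneg_nonneg)
  have "x n \<le> x\<^sub>0 (r n)" for n
    using scaleR_right_mono[OF t(2) x0(1)] by (simp add: x_def)
  then have w: "weakly_null x"
    by (rule weakly_null_dominated[OF weakly_null_subseq[OF x0(2) r(1)] x])
  have norm_x: "norm (x n) = min 1 (norm (x\<^sub>0 (r n)))" for n
    by (auto simp: x_def t_def max_def min_def)
  have e: "0 < e" "\<And>n. e \<le> norm (x n)" "\<And>n. norm (x n) \<le> 1"
    using r norm_x by (auto simp: e_def min_le_iff_disj)
  show thesis
  proof (cases "\<forall>z\<ge>0. \<exists>\<^sub>F n in sequentially. e / 2 \<le> norm (pprt (x n - z))")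
    case True
    then show thesis
      using disjoint_subsequence_not_order_dominated[OF w x e(3), of "e / 2"] e(1) that by (metis half_gt_zero)
  next
    case False
    then obtain z where z: "0 \<le> z" "\<forall>\<^sub>F n in sequentially. norm (pprt (x n - z)) < e / 2"
      by (auto simp: not_frequently not_le)
    then obtain N where N: "\<And>n. N \<le> n \<Longrightarrow> norm (pprt (x n - z)) < e / 2"
      by (auto simp: eventually_sequentially)
    define x' where "x' n = inf (x (n + N)) z" for n
    have x': "0 \<le> x' n" "x' n \<le> x (n + N)" for n using x z by (auto simp: x'_def)
    have "strict_mono (\<lambda>n. n + N)" by (simp add: strict_mono_def)
    then have "weakly_null (\<lambda>n. x (n + N))" by (rule weakly_null_subseq[OF w])
    then have "weakly_null x'" using x' by (rule weakly_null_dominated)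
    moreover have "norm (x' n) \<le> 1" for n
      using norm_mono_nonneg[OF x'] e(3) order_trans by blast
    moreover have "e / 2 \<le> norm (x' n)" for n
    proof -
      have "x (n + N) = x' n + pprt (x (n + N) - z)"
      proof -
        have "pprt (x (n + N) - z) + z = sup (x (n + N)) z"
          by (simp add: pprt_def add_sup_distrib_right)
        then have "x' n + pprt (x (n + N) - z) + z = x (n + N) + z"
          using add_eq_inf_sup[of "x (n + N)" z] by (simp add: x'_def add.assoc add.commute)
        then show ?thesis by simp
      qed
      then have "e \<le> norm (x' n) + norm (pprt (x (n + N) - z))"
        using e(2)[of "n + N"] norm_triangle_ineq[of "x' n" "pprt (x (n + N) - z)"] by simp
      then show ?thesis using N[of "n + N"] by simp
    qed
    moreover have "x' n \<le> z" for n by (simp add: x'_def)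
    moreover have "0 < e / 2" using e(1) by simp
    ultimately show thesis
      using disjoint_subsequence_order_bounded[of x' "e / 2" z] x'(1) z(1) that by metis
  qed
qed

section \<open>Blockwise multiples of a sequence\<close>

lemma scaleR_inf:
  fixes a b :: "'e::banach_lattice"
  assumes "0 \<le> t" shows "t *\<^sub>R inf a b = inf (t *\<^sub>R a) (t *\<^sub>R b)"
proof -
  have "t *\<^sub>R inf a b = - (t *\<^sub>R sup (- a) (- b))"
    by (simp only: inf_eq_neg_sup[of a b] scaleR_minus_right)
  also have "\<dots> = - sup (- (t *\<^sub>R a)) (- (t *\<^sub>R b))"
    by (simp only: scaleR_sup[OF assms] scaleR_minus_right)
  finally show ?thesis by (simp only: inf_eq_neg_sup[of "t *\<^sub>R a"])
qed

lemma sup_scaleR_left: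
  fixes x :: "'e::banach_lattice"
  assumes "0 \<le> x" shows "sup (a *\<^sub>R x) (c *\<^sub>R x) = max a c *\<^sub>R x"
  using scaleR_right_mono[OF _ assms, of a c] scaleR_right_mono[OF _ assms, of c a]
  by (cases "a \<le> c") (simp_all add: max_def sup_absorb1 sup_absorb2)

lemma inf_scaleR_left:
  fixes x :: "'e::banach_lattice"
  assumes "0 \<le> x" shows "inf (a *\<^sub>R x) (c *\<^sub>R x) = min a c *\<^sub>R x"
  using scaleR_right_mono[OF _ assms, of a c] scaleR_right_mono[OF _ assms, of c a]
  by (cases "a \<le> c") (simp_all add: min_def inf_absorb1 inf_absorb2)

text \<open>
  The fibres of \<open>b\<close> are the blocks. They will be infinite, so that every nonzero coefficient recurs infinitely
  often. For \<open>y\<close> bounded, with norms bounded away from \<open>0\<close>, this is a copy of the real sequence space \<open>\<ell>\<^sub>\<infinity>\<close>.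
\<close>

definition blockwise_multiples :: "(nat \<Rightarrow> nat) \<Rightarrow> (nat \<Rightarrow> 'e::banach_lattice) \<Rightarrow> (nat \<Rightarrow> 'e) set" where
  "blockwise_multiples b y = {z \<in> linfty. \<exists>a. \<forall>n. z n = a (b n) *\<^sub>R y n}"

lemma infinite_blocks_exist: "\<exists>b :: nat \<Rightarrow> nat. \<forall>i. infinite {n. b n = i}"
proof (intro exI allI)
  fix i
  have "range (\<lambda>j. prod_encode (i, j)) \<subseteq> {n. (fst \<circ> prod_decode) n = i}" by auto
  moreover have "inj (\<lambda>j. prod_encode (i, j))" by (simp add: inj_on_def)
  ultimately show "infinite {n. (fst \<circ> prod_decode) n = i}"
    using finite_subset range_inj_infinite by blast
qed

lemma subspace_blockwise_multiples: "subspace (blockwise_multiples b y)"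
proof (rule subspaceI)
  show "0 \<in> blockwise_multiples b y"
    using subspace_0[OF subspace_linfty]
    by (auto simp: blockwise_multiples_def intro!: exI[of _ "\<lambda>_. 0"])
next
  fix u w assume "u \<in> blockwise_multiples b y" "w \<in> blockwise_multiples b y"
  then obtain a c where "u \<in> linfty" "w \<in> linfty"
    and uw: "\<And>n. u n = a (b n) *\<^sub>R y n" "\<And>n. w n = c (b n) *\<^sub>R y n"
    by (auto simp: blockwise_multiples_def)
  then have "u + w \<in> linfty" using subspace_add[OF subspace_linfty] by blast
  moreover have "(u + w) n = (a (b n) + c (b n)) *\<^sub>R y n" for n by (simp add: uw scaleR_add_left)
  ultimately show "u + w \<in> blockwise_multiples b y"
    by (auto simp: blockwise_multiples_def intro!: exI[of _ "\<lambda>i. a i + c i"])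
next
  fix t u assume "u \<in> blockwise_multiples b y"
  then obtain a where "u \<in> linfty" and u: "\<And>n. u n = a (b n) *\<^sub>R y n"
    by (auto simp: blockwise_multiples_def)
  then have "t *\<^sub>R u \<in> linfty" using subspace_scale[OF subspace_linfty] by blast
  moreover have "(t *\<^sub>R u) n = (t * a (b n)) *\<^sub>R y n" for n by (simp add: u scaleR_fun_def)
  ultimately show "t *\<^sub>R u \<in> blockwise_multiples b y"
    by (auto simp: blockwise_multiples_def intro!: exI[of _ "\<lambda>i. t * a i"])
qed

lemma sublattice_blockwise_multiples:
  assumes y: "\<And>n. 0 \<le> y n"
  shows "sublattice_of linfty (blockwise_multiples b y)"
  unfolding sublattice_of_def
proof (intro conjI ballI)
  show "blockwise_multiples b y \<subseteq> linfty" by (auto simp: blockwise_multiples_def)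
  show "subspace (blockwise_multiples b y)" by (rule subspace_blockwise_multiples)
  fix u w assume "u \<in> blockwise_multiples b y" "w \<in> blockwise_multiples b y"
  then obtain a c where mem: "u \<in> linfty" "w \<in> linfty"
    and uw: "\<And>n. u n = a (b n) *\<^sub>R y n" "\<And>n. w n = c (b n) *\<^sub>R y n"
    by (auto simp: blockwise_multiples_def)
  have lub: "isLub linfty {u, w} (sup u w)" and glb: "isGlb linfty {u, w} (inf u w)"
    using mem by (rule isLub_linfty, rule isGlb_linfty)
  have "sup u w n = max (a (b n)) (c (b n)) *\<^sub>R y n" for n
    by (simp add: uw sup_scaleR_left[OF y])
  moreover have "sup u w \<in> linfty" using lub by (rule isLubD1a)
  ultimately show "sup_in linfty u w \<in> blockwise_multiples b y"
    unfolding sup_in_eq[OF lub] blockwise_multiples_def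
    by (auto intro!: exI[of _ "\<lambda>i. max (a i) (c i)"])
  have "inf u w n = min (a (b n)) (c (b n)) *\<^sub>R y n" for n
    by (simp add: uw inf_scaleR_left[OF y])
  moreover have "inf u w \<in> linfty"
    using glb by (simp add: isGlb_def greatestP_def isLb_def)
  ultimately show "inf_in linfty u w \<in> blockwise_multiples b y"
    unfolding inf_in_eq[OF glb] blockwise_multiples_def
    by (auto intro!: exI[of _ "\<lambda>i. min (a i) (c i)"])
qed

text \<open>
  On a block the coefficient can be read off from a single coordinate by a norming functional, so it
  depends continuously on the sequence; coordinatewise limits thus stay of the same form.
\<close>

lemma closed_blockwise_multiples:
  fixes y :: "nat \<Rightarrow> 'e::banach_lattice"
  assumes y: "\<And>n. 0 \<le> y n" "\<And>n. y n \<noteq> 0" and b: "\<And>i. infinite {n. b n = i}"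
  shows "closedin (Metric_space.mtopology linfty (norm_dist linfty sup_norm)) (blockwise_multiples b y)"
proof -
  interpret L: Metric_space linfty "norm_dist linfty (sup_norm :: (nat \<Rightarrow> 'e) \<Rightarrow> real)"
    by (rule Metric_space_linfty)
  show ?thesis
    unfolding L.metric_closedin_iff_sequentially_closed
  proof (intro conjI allI impI)
    show "blockwise_multiples b y \<subseteq> linfty" by (auto simp: blockwise_multiples_def)
    fix \<sigma> :: "nat \<Rightarrow> nat \<Rightarrow> 'e" and l
    assume \<sigma>: "range \<sigma> \<subseteq> blockwise_multiples b y \<and> limitin L.mtopology \<sigma> l sequentially"
    then have l: "l \<in> linfty"
      and lim: "\<And>e. 0 < e \<Longrightarrow> \<forall>\<^sub>F k in sequentially. \<sigma> k \<in> linfty \<and> norm_dist linfty sup_norm (\<sigma> k) l < e"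
      by (auto simp: L.limitin_metric)
    have coord: "(\<lambda>k. \<sigma> k n) \<longlonglongrightarrow> l n" for n
    proof (rule tendstoI)
      fix e :: real assume "0 < e"
      from lim[OF this] show "\<forall>\<^sub>F k in sequentially. dist (\<sigma> k n) (l n) < e"
      proof (rule eventually_mono)
        fix k assume k: "\<sigma> k \<in> linfty \<and> norm_dist linfty sup_norm (\<sigma> k) l < e"
        then have "norm ((\<sigma> k - l) n) \<le> sup_norm (\<sigma> k - l)"
          using l by (intro norm_le_sup_norm subspace_diff[OF subspace_linfty]) auto
        moreover have "sup_norm (\<sigma> k - l) < e" using k l by (auto simp: norm_dist_def)
        ultimately show "dist (\<sigma> k n) (l n) < e" by (simp add: dist_norm)
      qed
    qed
    have "\<sigma> k \<in> blockwise_multiples b y" for k using \<sigma> by blast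
    then have "\<forall>k. \<exists>a. \<forall>n. \<sigma> k n = a (b n) *\<^sub>R y n"
      by (simp add: blockwise_multiples_def)
    then obtain a where a: "\<And>k n. \<sigma> k n = a k (b n) *\<^sub>R y n" by metis
    have "\<exists>c. (\<lambda>k. a k i) \<longlonglongrightarrow> c" for i
    proof -
      obtain m where m: "b m = i" using b[of i] by (metis (mono_tags) empty_Collect_eq finite.emptyI)
      obtain g :: "'e \<Rightarrow>\<^sub>L real" where g: "blinfun_apply g (y m) = norm (y m)"
        using positive_norming_functional[OF y(1)] by metis
      have "(\<lambda>k. blinfun_apply g (\<sigma> k m) / norm (y m)) \<longlonglongrightarrow> g (l m) / norm (y m)"
        using y(2)[of m] by (intro tendsto_divide blinfun.tendsto coord tendsto_const) auto
      moreover have "blinfun_apply g (\<sigma> k m) / norm (y m) = a k i" for k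
        using y(2)[of m] by (simp add: a m blinfun.scaleR_right g)
      ultimately show ?thesis by auto
    qed
    then obtain c where c: "\<And>i. (\<lambda>k. a k i) \<longlonglongrightarrow> c i" by metis
    have "l n = c (b n) *\<^sub>R y n" for n
    proof (rule LIMSEQ_unique[OF coord])
      show "(\<lambda>k. \<sigma> k n) \<longlonglongrightarrow> c (b n) *\<^sub>R y n"
        unfolding a by (intro tendsto_scaleR c tendsto_const)
    qed
    then show "l \<in> blockwise_multiples b y" using l by (auto simp: blockwise_multiples_def)
  qed
qed

text \<open>
  The restrictions of \<open>y\<close> to the blocks are linearly independent, having nonempty disjoint supports.
\<close>

lemma infinite_dimensional_blockwise_multiples:
  fixes y :: "nat \<Rightarrow> 'e::banach_lattice"
  assumes y: "y \<in> linfty" "\<And>n. y n \<noteq> 0" and b: "\<And>i. infinite {n. b n = i}"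
  shows "infinite_dimensional (blockwise_multiples b y)"
  unfolding infinite_dimensional_def
proof
  assume "\<exists>B. finite B \<and> blockwise_multiples b y \<subseteq> span B"
  then obtain B where B: "finite B" "blockwise_multiples b y \<subseteq> span B" by blast
  define e where "e i n = (if b n = i then y n else 0)" for i n
  have "\<forall>i. \<exists>n. b n = i" using b by (metis (mono_tags) empty_Collect_eq finite.emptyI)
  then obtain m where m: "\<And>i. b (m i) = i" by metis
  have em: "e i (m j) = (if i = j then y (m j) else 0)" for i j by (simp add: e_def m)
  have "inj e" using em y(2) by (intro injI) metis
  have "e i \<in> blockwise_multiples b y" for i
  proof -
    have "norm (e i n) \<le> sup_norm y" for n
      using norm_le_sup_norm[OF y(1), of n] norm_ge_zero[of "y n"] by (auto simp: e_def simp del: norm_ge_zero)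
    then have "e i \<in> linfty" by (rule linftyI)
    moreover have "e i n = (if b n = i then 1 else 0) *\<^sub>R y n" for n by (simp add: e_def)
    ultimately show ?thesis
      unfolding blockwise_multiples_def by (auto intro!: exI[of _ "\<lambda>j. if j = i then 1 else 0"])
  qed
  then have "range e \<subseteq> span B" using B(2) by blast
  moreover have "independent (range e)"
    unfolding independent_explicit_module
  proof (intro allI impI)
    fix t and u :: "(nat \<Rightarrow> 'e) \<Rightarrow> real" and v
    assume t: "finite t" "t \<subseteq> range e" "(\<Sum>w\<in>t. u w *\<^sub>R w) = 0" "v \<in> t"
    then obtain i where i: "v = e i" by blast
    have eval: "(\<Sum>w\<in>s. u w *\<^sub>R w) n = (\<Sum>w\<in>s. u w *\<^sub>R w n)" if "finite s" for s n
      using that by induction (simp_all add: scaleR_fun_def)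
    have "(\<Sum>w\<in>t. u w *\<^sub>R w (m i)) = (\<Sum>w\<in>t. if w = v then u v *\<^sub>R y (m i) else 0)"
    proof (rule sum.cong[OF refl])
      fix w assume "w \<in> t"
      then obtain j where "w = e j" using t(2) by blast
      then show "u w *\<^sub>R w (m i) = (if w = v then u v *\<^sub>R y (m i) else 0)"
        using i \<open>inj e\<close> by (auto simp: em inj_eq)
    qed
    also have "\<dots> = u v *\<^sub>R y (m i)" using t by simp
    finally have "u v *\<^sub>R y (m i) = 0" using eval[OF t(1), of "m i"] t(3) by simp
    then show "u v = 0" using y(2) by simp
  qed
  ultimately have "finite (range e)" using independent_span_bound[OF B(1)] by blast
  then show False using \<open>inj e\<close> by (simp add: finite_image_iff)
qed

text \<open>
  A nonzero coefficient keeps the norm away from \<open>0\<close> along its whole infinite block, and boundedness of \<open>z\<close>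
  bounds the coefficients since \<open>y\<close> is bounded below in norm.
\<close>

lemma blockwise_multiple_nonzero:
  fixes y :: "nat \<Rightarrow> 'e::banach_lattice"
  assumes y: "\<And>n. e \<le> norm (y n)" "0 < e" and b: "\<And>i. infinite {n. b n = i}"
    and z: "z \<in> blockwise_multiples b y" "z \<noteq> 0"
  shows "\<not> z \<longlonglongrightarrow> 0" "\<exists>c. \<forall>n. \<bar>z n\<bar> \<le> \<bar>c *\<^sub>R y n\<bar>"
proof -
  obtain a where z': "z \<in> linfty" and a: "\<And>n. z n = a (b n) *\<^sub>R y n"
    using z by (auto simp: blockwise_multiples_def)
  have norm_z: "\<bar>a (b n)\<bar> * e \<le> norm (z n)" for n
    using y(1)[of n] by (simp add: a mult_left_mono)
  show "\<not> z \<longlonglongrightarrow> 0"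
  proof
    assume null: "z \<longlonglongrightarrow> 0"
    obtain n0 where "z n0 \<noteq> 0" using z(2) by (auto simp: fun_eq_iff)
    then have pos: "0 < \<bar>a (b n0)\<bar> * e" using y(2) by (simp add: a)
    have "\<forall>\<^sub>F n in sequentially. norm (z n) < \<bar>a (b n0)\<bar> * e"
      using tendsto_norm_zero[OF null] pos by (rule order_tendstoD)
    then obtain N where N: "\<And>n. N \<le> n \<Longrightarrow> norm (z n) < \<bar>a (b n0)\<bar> * e"
      by (auto simp: eventually_sequentially)
    obtain n where "N \<le> n" "b n = b n0" using b[of "b n0"] by (auto simp: infinite_nat_iff_unbounded_le)
    then show False using N[of n] norm_z[of n] by simp
  qed
  have "\<bar>z n\<bar> \<le> \<bar>(sup_norm z / e) *\<^sub>R y n\<bar>" for n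
  proof -
    have "\<bar>a (b n)\<bar> * e \<le> sup_norm z"
      using norm_z norm_le_sup_norm[OF z'] by (rule order_trans)
    then have "\<bar>a (b n)\<bar> \<le> sup_norm z / e" using y(2) by (simp add: field_simps)
    then have "\<bar>a (b n)\<bar> \<le> \<bar>sup_norm z / e\<bar>" using abs_ge_self by (rule order_trans)
    then show ?thesis by (simp only: a abs_scaleR) (intro scaleR_right_mono abs_ge_zero)
  qed
  then show "\<exists>c. \<forall>n. \<bar>z n\<bar> \<le> \<bar>c *\<^sub>R y n\<bar>" by blast
qed

lemma disjoint_sequence_dominated:
  assumes "disjoint_sequence y" "\<And>n. \<bar>z n\<bar> \<le> \<bar>c *\<^sub>R y n\<bar>"
  shows "disjoint_sequence z"
  unfolding disjoint_sequence_def
proof (intro allI impI)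
  fix j k :: nat assume "j \<noteq> k"
  then have "inf \<bar>y j\<bar> \<bar>y k\<bar> = 0" using assms(1) by (simp add: disjoint_sequence_def)
  then have "inf \<bar>c *\<^sub>R y j\<bar> \<bar>c *\<^sub>R y k\<bar> = 0"
    by (simp add: abs_scaleR flip: scaleR_inf)
  moreover have "inf \<bar>z j\<bar> \<bar>z k\<bar> \<le> inf \<bar>c *\<^sub>R y j\<bar> \<bar>c *\<^sub>R y k\<bar>"
    by (intro inf_mono assms(2))
  ultimately have "inf \<bar>z j\<bar> \<bar>z k\<bar> \<le> 0" by simp
  then show "inf \<bar>z j\<bar> \<bar>z k\<bar> = 0" by (rule order.antisym) simp
qed

lemma disjoint_sequence_subseq: "disjoint_sequence x \<Longrightarrow> strict_mono r \<Longrightarrow> disjoint_sequence (x \<circ> r)"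
  unfolding disjoint_sequence_def by (simp add: strict_mono_eq)

lemma closed_sublattice_through_subsequence:
  fixes x :: "nat \<Rightarrow> 'e::banach_lattice"
  assumes x: "x \<in> linfty" "0 \<le> x" "\<not> x \<longlonglongrightarrow> 0"
  obtains Y r where "sublattice_of linfty Y"
    "closedin (Metric_space.mtopology linfty (norm_dist linfty sup_norm)) Y"
    "infinite_dimensional Y" "strict_mono r" "x \<circ> r \<in> Y"
    "\<And>z. z \<in> Y \<Longrightarrow> z \<noteq> 0 \<Longrightarrow>
       z \<in> linfty \<and> \<not> z \<longlonglongrightarrow> 0 \<and> (\<exists>c. \<forall>n. \<bar>z n\<bar> \<le> \<bar>c *\<^sub>R (x \<circ> r) n\<bar>)"
proof -
  obtain r :: "nat \<Rightarrow> nat" and e where r: "strict_mono r" "0 < e" "\<And>n. e \<le> norm (x (r n))"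
    using not_null_subsequence[OF x(3)] by blast
  obtain b :: "nat \<Rightarrow> nat" where b: "\<And>i. infinite {n. b n = i}" using infinite_blocks_exist by blast
  define y where "y = x \<circ> r"
  have y: "\<And>n. 0 \<le> y n" "\<And>n. e \<le> norm (y n)" using x(2) r by (auto simp: y_def le_fun_def)
  have y0: "y n \<noteq> 0" for n using r(2) y(2)[of n] by auto
  have "norm (y n) \<le> sup_norm x" for n using norm_le_sup_norm[OF x(1)] by (simp add: y_def)
  then have yl: "y \<in> linfty" by (rule linftyI)
  show thesis
  proof (rule that[of "blockwise_multiples b y" r])
    show "sublattice_of linfty (blockwise_multiples b y)"
      using y(1) by (rule sublattice_blockwise_multiples)
    show "closedin (Metric_space.mtopology linfty (norm_dist linfty sup_norm)) (blockwise_multiples b y)"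
      using y(1) y0 b by (rule closed_blockwise_multiples)
    show "infinite_dimensional (blockwise_multiples b y)"
      using yl y0 b by (rule infinite_dimensional_blockwise_multiples)
    show "strict_mono r" by (rule r(1))
    show "x \<circ> r \<in> blockwise_multiples b y"
      using yl by (auto simp: blockwise_multiples_def y_def intro!: exI[of _ "\<lambda>_. 1"])
    fix z assume z: "z \<in> blockwise_multiples b y" "z \<noteq> 0"
    then have "z \<in> linfty" by (simp add: blockwise_multiples_def)
    then show "z \<in> linfty \<and> \<not> z \<longlonglongrightarrow> 0 \<and> (\<exists>c. \<forall>n. \<bar>z n\<bar> \<le> \<bar>c *\<^sub>R (x \<circ> r) n\<bar>)"
      using blockwise_multiple_nonzero[OF y(2) r(2) b z] by (simp add: y_def)
  qed
qed

section \<open>Almost positive pointwise latticeability\<close>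

text \<open>
  Every nonzero element of the sublattice through \<open>x \<circ> r\<close> is dominated by a multiple of \<open>x \<circ> r\<close>, so any property
  stable under subsequences and domination is inherited. Both absolute weak nullity and disjointness
  are of this kind.
\<close>

lemma almost_positive_pointwise_latticeable_if_dominated_closed:
  fixes P :: "(nat \<Rightarrow> 'e::banach_lattice) \<Rightarrow> bool"
  assumes subseq: "\<And>x r. P x \<Longrightarrow> strict_mono r \<Longrightarrow> P (x \<circ> r)"
    and dominated: "\<And>x z c. P x \<Longrightarrow> (\<And>n. \<bar>z n\<bar> \<le> \<bar>c *\<^sub>R x n\<bar>) \<Longrightarrow> P z"
    and ex: "0 \<le> x\<^sub>0" "x\<^sub>0 \<in> linfty" "P x\<^sub>0" "\<not> x\<^sub>0 \<longlonglongrightarrow> 0"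
  shows "almost_positive_pointwise_latticeable linfty sup_norm {x \<in> linfty. P x \<and> \<not> x \<longlonglongrightarrow> 0}"
  unfolding almost_positive_pointwise_latticeable_def
proof (intro conjI ballI impI)
  show "banach_sequence_lattice linfty (sup_norm :: (nat \<Rightarrow> 'e) \<Rightarrow> real)"
    by (rule banach_sequence_lattice_linfty)
  show "\<exists>x\<in>{x \<in> linfty. P x \<and> \<not> x \<longlonglongrightarrow> 0}. 0 \<le> x" using ex by blast
  fix x assume x: "x \<in> {x \<in> linfty. P x \<and> \<not> x \<longlonglongrightarrow> 0}" "0 \<le> x"
  then obtain Y r where Y: "sublattice_of linfty Y"
    "closedin (Metric_space.mtopology linfty (norm_dist linfty sup_norm)) Y"
    "infinite_dimensional Y" "strict_mono r" "x \<circ> r \<in> Y"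
    and nz: "\<And>z. z \<in> Y \<Longrightarrow> z \<noteq> 0 \<Longrightarrow>
       z \<in> linfty \<and> \<not> z \<longlonglongrightarrow> 0 \<and> (\<exists>c. \<forall>n. \<bar>z n\<bar> \<le> \<bar>c *\<^sub>R (x \<circ> r) n\<bar>)"
    using closed_sublattice_through_subsequence[of x] by (metis (no_types, lifting) mem_Collect_eq)
  have "P (x \<circ> r)" using x Y(4) by (auto intro: subseq)
  then have "Y \<subseteq> {x \<in> linfty. P x \<and> \<not> x \<longlonglongrightarrow> 0} \<union> {0}"
    using nz dominated by blast
  then show "\<exists>Y. sublattice_of linfty Y \<and>
      closedin (Metric_space.mtopology linfty (norm_dist linfty sup_norm)) Y \<and>
      infinite_dimensional Y \<and> Y \<subseteq> {x \<in> linfty. P x \<and> \<not> x \<longlonglongrightarrow> 0} \<union> {0} \<and>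
      (\<exists>r. strict_mono r \<and> x \<circ> r \<in> Y)"
    using Y by blast
qed blast

theorem corollary4p9:
  assumes "\<not> positive_schur_property TYPE('e::banach_lattice)"
  shows "almost_positive_pointwise_latticeable linfty sup_norm
           {x :: nat \<Rightarrow> 'e. x \<in> linfty \<and> absolutely_weakly_null x \<and> \<not> x \<longlonglongrightarrow> 0}
       \<and> almost_positive_pointwise_latticeable linfty sup_norm
           {x :: nat \<Rightarrow> 'e. x \<in> linfty \<and> disjoint_sequence x \<and> absolutely_weakly_null x \<and>
              \<not> x \<longlonglongrightarrow> 0}"
proof -
  obtain y :: "nat \<Rightarrow> 'e" where y: "disjoint_sequence y" "weakly_null y" "\<And>k. 0 \<le> y k"
    "\<And>k. norm (y k) \<le> 1" "\<not> y \<longlonglongrightarrow> 0"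
    using positive_disjoint_weakly_null_exists[OF assms] by blast
  have ex: "0 \<le> y" "y \<in> linfty" "absolutely_weakly_null y"
    using y(3) linftyI[OF y(4)] y(2) absolutely_weakly_null_nonneg_iff[OF y(3)]
    by (simp_all add: le_fun_def)
  have "almost_positive_pointwise_latticeable linfty sup_norm
      {x :: nat \<Rightarrow> 'e. x \<in> linfty \<and> absolutely_weakly_null x \<and> \<not> x \<longlonglongrightarrow> 0}"
    by (rule almost_positive_pointwise_latticeable_if_dominated_closed
        [OF absolutely_weakly_null_subseq absolutely_weakly_null_dominated ex(1,2,3) y(5)])
  moreover have "almost_positive_pointwise_latticeable linfty sup_norm
      {x :: nat \<Rightarrow> 'e. x \<in> linfty \<and> (disjoint_sequence x \<and> absolutely_weakly_null x) \<and> \<not> x \<longlonglongrightarrow> 0}"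
  proof (rule almost_positive_pointwise_latticeable_if_dominated_closed)
    show "0 \<le> y" "y \<in> linfty" "disjoint_sequence y \<and> absolutely_weakly_null y" "\<not> y \<longlonglongrightarrow> 0"
      using ex y by auto
  qed (auto intro: disjoint_sequence_subseq absolutely_weakly_null_subseq
      disjoint_sequence_dominated absolutely_weakly_null_dominated)
  ultimately show ?thesis by (simp only: conj_assoc)
qed

end
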